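(* Let $H$ be a cocommutative Hopf algebra over a field $\mathbf{k}$, let $Y$ be an $H$-bimodule which is also a commutative associative $H$-differential algebra for both the left and the right actions of $H$, and let $(\mathcal{L},\{\beta_k\}_{k\ge1})$ be an $L_\infty$ $H$-pseudoalgebra. Put $\mathcal{A}_Y\mathcal{L}=Y\otimes_H\mathcal{L}$ and define $\widetilde{\beta}_k:(\mathcal{A}_Y\mathcal{L})^{\otimes k}\to\mathcal{A}_Y\mathcal{L}$, $k\ge1$, by $$\widetilde{\beta}_k(y_1\otimes_Hx_1,\dots,y_k\otimes_Hx_k)=\sum_i(y_1f_{1i})\cdots(y_kf_{ki})\otimes_He_i\quad\text{if}\quad\beta_k(x_1,\dots,x_k)=\sum_i(f_{1i}\otimes\cdots\otimes f_{ki})\otimes_He_i.$$ Then $(\mathcal{A}_Y\mathcal{L},\{\widetilde{\beta}_k\}_{k\ge1})$ is an $L_\infty$ algebra, and its structure maps satisfy, for all $h\in H$, $$h\big(\widetilde{\beta}_k(y_1\otimes_Hx_1,\dots,y_k\otimes_Hx_k)\big)=\widetilde{\beta}_k\big(h_{(1)}(y_1\otimes_Hx_1),\dots,h_{(k)}(y_k\otimes_Hx_k)\big),$$ where $h(y\otimes_Hx)=hy\otimes_Hx$.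
   Context: $Y$ is concentrated in degree $0$. That $Y$ is an $H$-differential algebra for both actions means $h(yz)=(h_{(1)}y)(h_{(2)}z)$ and $(yz)h=(yh_{(1)})(zh_{(2)})$ for $h\in H$, $y,z\in Y$ (Sweedler notation, summation understood). $L_\infty$ $H$-pseudoalgebras. $H^{\otimes n}$ is a right $H$-module via $(h_1\otimes\cdots\otimes h_n)h=h_1h_{(1)}\otimes\cdots\otimes h_nh_{(n)}$. $\mathrm{Hom}^p_{H^{\otimes n}}(\mathcal{L}^{\boxtimes n},H^{\otimes n}\otimes_H\mathcal{L})$ is the space of degree $p$, $H^{\otimes n}$-linear maps $\mathcal{L}^{\otimes n}\to H^{\otimes n}\otimes_H\mathcal{L}$ (factorwise action on the source, left multiplication on the target). Composition: if $\psi(y_1,\dots,y_l)=\sum_i(h_i^1\otimes\cdots\otimes h_i^l)\otimes_He_i$ and $\varphi(e_i,x_2,\dots,x_k)=\sum_j(f_{ij}^1\otimes\cdots\otimes f_{ij}^k)\otimes_He_{ij}$, then $\varphi(\psi(y_1,\dots,y_l),x_2,\dots,x_k)=\sum_{i,j}(h_i^1f^1_{ij(1)}\otimes\cdots\otimes h_i^lf^1_{ij(l)}\otimes f_{ij}^2\otimes\cdots\otimes f_{ij}^k)\otimes_He_{ij}$. For $\sigma\in S_N$, $P_\sigma$ moves the $j$-th factor of $H^{\otimes N}$ to position $\sigma(j)$; $(-1)^\sigma$ is the signature and $\epsilon(\sigma)$ the Koszul sign of $(x_1,\dots,x_N)\mapsto(x_{\sigma(1)},\dots,x_{\sigma(N)})$;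 $\mathrm{Sh}(l,k-1)$ is the set of $\sigma\in S_{l+k-1}$ increasing on $\{1,\dots,l\}$ and on $\{l+1,\dots,l+k-1\}$. An $L_\infty$ $H$-pseudoalgebra is a graded left $H$-module $\mathcal{L}=\oplus_{n\in\mathbb{Z}}\mathcal{L}^n$ with $\beta_k\in\mathrm{Hom}^{k-2}_{H^{\otimes k}}(\mathcal{L}^{\boxtimes k},H^{\otimes k}\otimes_H\mathcal{L})$, $k\ge1$, such that $\beta_k(x_1,\dots,x_k)=(-1)^\sigma\epsilon(\sigma)(P_\sigma\otimes_H1)\beta_k(x_{\sigma(1)},\dots,x_{\sigma(k)})$ for all $\sigma\in S_k$ and, for all $N\ge1$ and homogeneous $x_1,\dots,x_N$, $$\sum_{k+l=N+1}\sum_{\sigma\in\mathrm{Sh}(l,k-1)}(-1)^\sigma\epsilon(\sigma)(-1)^{l(k-1)}(P_\sigma\otimes_H1)\beta_k\big(\beta_l(x_{\sigma(1)},\dots,x_{\sigma(l)}),x_{\sigma(l+1)},\dots,x_{\sigma(N)}\big)=0.$$ An $L_\infty$ algebra is the case $H=\mathbf{k}$: a graded vector space with graded skew-symmetric maps of degree $k-2$ satisfying the same identities (with no $P_\sigma$). *)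

theory Defs
  imports Complex_Main "HOL-Library.Poly_Mapping" "HOL-Combinatorics.Permutations"
begin

section \<open>Free vector spaces and their quotients\<close>

text \<open>
  The free vector space on a type \<open>'b\<close> over a field \<open>'k\<close> is \<open>'b \<Rightarrow>\<^sub>0 'k\<close>.
\<close>

definition fscale :: "'k::field \<Rightarrow> ('b \<Rightarrow>\<^sub>0 'k) \<Rightarrow> ('b \<Rightarrow>\<^sub>0 'k)" where
  "fscale c u = Poly_Mapping.map ((*) c) u"

lemma lookup_fscale: "Poly_Mapping.lookup (fscale c u) b = c * Poly_Mapping.lookup u b"
  unfolding fscale_def by transfer (auto simp: when_def)

interpretation free: vector_space "fscale :: 'k::field \<Rightarrow> ('b \<Rightarrow>\<^sub>0 'k) \<Rightarrow> ('b \<Rightarrow>\<^sub>0 'k)"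
  by unfold_locales
    (auto intro!: poly_mapping_eqI simp: lookup_fscale lookup_add algebra_simps)

definition gen :: "'b \<Rightarrow> ('b \<Rightarrow>\<^sub>0 'k::field)" where
  "gen b = Poly_Mapping.single b 1"

text \<open>The linear extension of a map defined on the generators.\<close>

definition lin_ext :: "('k::field \<Rightarrow> 'v \<Rightarrow> 'v::ab_group_add) \<Rightarrow> ('b \<Rightarrow> 'v) \<Rightarrow> ('b \<Rightarrow>\<^sub>0 'k) \<Rightarrow> 'v" where
  "lin_ext s f u = (\<Sum>b\<in>Poly_Mapping.keys u. s (Poly_Mapping.lookup u b) (f b))"

text \<open>
  The quotient of a free vector space \<open>V\<close> by the subspace spanned by a set \<open>R\<close> of relations is
  realised on a linear complement of \<open>span R\<close>: \<open>quot_map R\<close> is an idempotent linear map with kernel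
  exactly \<open>span R\<close>, so that its range, with \<open>quot_map R\<close> as canonical projection, is \<open>V / span R\<close>.
  In particular every class is itself an element of \<open>V\<close> that represents it, and the map on the
  quotient induced by a linear map that kills \<open>R\<close> is just the restriction of that map.
\<close>

definition is_quot_map :: "('b \<Rightarrow>\<^sub>0 'k::field) set \<Rightarrow> (('b \<Rightarrow>\<^sub>0 'k) \<Rightarrow> ('b \<Rightarrow>\<^sub>0 'k)) \<Rightarrow> bool" where
  "is_quot_map R p \<longleftrightarrow> Vector_Spaces.linear fscale fscale p \<and> (\<forall>u. p (p u) = p u) \<and>
     (\<forall>u. p u = 0 \<longleftrightarrow> u \<in> free.span R)"

definition quot_map :: "('b \<Rightarrow>\<^sub>0 'k::field) set \<Rightarrow> ('b \<Rightarrow>\<^sub>0 'k) \<Rightarrow> ('b \<Rightarrow>\<^sub>0 'k)" where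
  "quot_map R = (SOME p. is_quot_map R p)"

lemma is_quot_map_quot_map:
  fixes R :: "('b \<Rightarrow>\<^sub>0 'k::field) set"
  shows "is_quot_map R (quot_map R)"
proof -
  interpret pr: vector_space_pair "fscale :: 'k \<Rightarrow> ('b \<Rightarrow>\<^sub>0 'k) \<Rightarrow> _" "fscale :: 'k \<Rightarrow> ('b \<Rightarrow>\<^sub>0 'k) \<Rightarrow> _"
    by unfold_locales
  let ?V = "free.span R"
  have "\<exists>g. range g \<subseteq> ?V \<and> Vector_Spaces.linear fscale fscale g \<and> (\<forall>v\<in>?V. g v = v)"
    using pr.linear_exists_left_inverse_on[OF free.linear_id free.subspace_span, of R]
    by (auto simp: inj_on_def)
  then obtain g where g: "range g \<subseteq> ?V" "Vector_Spaces.linear fscale fscale g" "\<And>v. v \<in> ?V \<Longrightarrow> g v = v"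
    by blast
  interpret g: Vector_Spaces.linear fscale fscale g by fact
  have gV: "g u \<in> ?V" for u using g(1) by auto
  have lin: "Vector_Spaces.linear fscale fscale (\<lambda>u. u - g u)"
    by (intro pr.linear_compose_sub free.linear_ident g(2))
  have "is_quot_map R (\<lambda>u. u - g u)"
    unfolding is_quot_map_def
  proof (intro conjI allI lin)
    fix u
    show "u - g u - g (u - g u) = u - g u"
      by (simp add: g.diff g(3)[OF gV])
    show "(u - g u = 0) = (u \<in> ?V)"
      using gV[of u] g(3)[of u] by auto
  qed
  then show ?thesis
    unfolding quot_map_def by (rule someI[where P = "is_quot_map R"])
qed


section \<open>Tensor powers\<close>

text \<open>
  \<open>V\<^bsup>\<otimes>n\<^esup>\<close> is a quotient of the free vector space on the lists over \<open>V\<close> of length \<open>n\<close>.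
\<close>

definition tp_rel :: "('k::field \<Rightarrow> 'v \<Rightarrow> 'v::ab_group_add) \<Rightarrow> nat \<Rightarrow> ('v list \<Rightarrow>\<^sub>0 'k) set" where
  "tp_rel s n =
     {gen (xs @ (a + b) # ys) - gen (xs @ a # ys) - gen (xs @ b # ys) | xs ys a b.
        length xs + length ys + 1 = n} \<union>
     {gen (xs @ s c a # ys) - fscale c (gen (xs @ a # ys)) | xs ys a c.
        length xs + length ys + 1 = n}"

definition pure :: "('k::field \<Rightarrow> 'v \<Rightarrow> 'v::ab_group_add) \<Rightarrow> 'v list \<Rightarrow> ('v list \<Rightarrow>\<^sub>0 'k)" where
  "pure s xs = quot_map (tp_rel s (length xs)) (gen xs)"

definition tpow :: "('k::field \<Rightarrow> 'v \<Rightarrow> 'v::ab_group_add) \<Rightarrow> nat \<Rightarrow> ('v list \<Rightarrow>\<^sub>0 'k) set" where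
  "tpow s n = free.span {pure s xs | xs. length xs = n}"

definition tconc :: "('k::field \<Rightarrow> 'v \<Rightarrow> 'v::ab_group_add) \<Rightarrow>
    ('v list \<Rightarrow>\<^sub>0 'k) \<Rightarrow> ('v list \<Rightarrow>\<^sub>0 'k) \<Rightarrow> ('v list \<Rightarrow>\<^sub>0 'k)" where
  "tconc s u v = lin_ext fscale (\<lambda>xs. lin_ext fscale (\<lambda>ys. pure s (xs @ ys)) v) u"

definition tmul :: "('k::field \<Rightarrow> 'v \<Rightarrow> 'v::ring) \<Rightarrow>
    ('v list \<Rightarrow>\<^sub>0 'k) \<Rightarrow> ('v list \<Rightarrow>\<^sub>0 'k) \<Rightarrow> ('v list \<Rightarrow>\<^sub>0 'k)" where
  "tmul s u v = lin_ext fscale (\<lambda>xs. lin_ext fscale (\<lambda>ys. pure s (map2 (*) xs ys)) v) u"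

text \<open>\<open>P\<^sub>\<sigma>\<close> moves factor \<open>j\<close> to position \<open>\<sigma> j\<close>; positions are counted from \<open>0\<close>.\<close>

definition tperm :: "('k::field \<Rightarrow> 'v \<Rightarrow> 'v::ab_group_add) \<Rightarrow> (nat \<Rightarrow> nat) \<Rightarrow>
    ('v list \<Rightarrow>\<^sub>0 'k) \<Rightarrow> ('v list \<Rightarrow>\<^sub>0 'k)" where
  "tperm s \<sigma> u = lin_ext fscale (\<lambda>xs. pure s (permute_list (inv \<sigma>) xs)) u"


section \<open>Cocommutative Hopf algebras and their modules\<close>

text \<open>
  The coproduct takes values in \<open>tpow sH 2\<close>, whose elements are combinations of lists \<open>[a, b]\<close>; hence
  \<open>lin_ext s (\<lambda>p. F (p ! 0) (p ! 1)) (cop h)\<close> is the Sweedler sum of \<open>F h\<^sub>(\<^sub>1\<^sub>) h\<^sub>(\<^sub>2\<^sub>)\<close>.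
\<close>

locale cocommutative_hopf_algebra = vector_space sH
  for sH :: "'k::field \<Rightarrow> 'h::ring_1 \<Rightarrow> 'h" +
  fixes cop :: "'h \<Rightarrow> ('h list \<Rightarrow>\<^sub>0 'k)" and eps :: "'h \<Rightarrow> 'k" and antipode :: "'h \<Rightarrow> 'h"
  assumes scale_mult_left: "sH c (g * h) = sH c g * h"
    and scale_mult_right: "sH c (g * h) = g * sH c h"
    and cop_in: "cop h \<in> tpow sH 2"
    and cop_linear: "Vector_Spaces.linear sH fscale cop"
    and cop_mult: "cop (g * h) = tmul sH (cop g) (cop h)"
    and cop_one: "cop 1 = pure sH [1, 1]"
    and eps_linear: "Vector_Spaces.linear sH (*) eps"
    and eps_mult: "eps (g * h) = eps g * eps h"
    and eps_one: "eps 1 = 1"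
    and coassoc: "lin_ext fscale (\<lambda>p. tconc sH (cop (p ! 0)) (pure sH [p ! 1])) (cop h) =
                  lin_ext fscale (\<lambda>p. tconc sH (pure sH [p ! 0]) (cop (p ! 1))) (cop h)"
    and counit_left: "lin_ext sH (\<lambda>p. sH (eps (p ! 0)) (p ! 1)) (cop h) = h"
    and counit_right: "lin_ext sH (\<lambda>p. sH (eps (p ! 1)) (p ! 0)) (cop h) = h"
    and antipode_linear: "Vector_Spaces.linear sH sH antipode"
    and antipode_left: "lin_ext sH (\<lambda>p. antipode (p ! 0) * p ! 1) (cop h) = sH (eps h) 1"
    and antipode_right: "lin_ext sH (\<lambda>p. p ! 0 * antipode (p ! 1)) (cop h) = sH (eps h) 1"
    and cocommutative: "tperm sH (transpose 0 1) (cop h) = cop h"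

text \<open>
  The iterated coproduct \<open>h \<mapsto> h\<^sub>(\<^sub>1\<^sub>) \<otimes> \<dots> \<otimes> h\<^sub>(\<^sub>n\<^sub>)\<close> with values in \<open>H\<^bsup>\<otimes>n\<^esup>\<close>. It is the counit for \<open>n = 0\<close>,
  whence by the counit axiom the identity for \<open>n = 1\<close> and the coproduct for \<open>n = 2\<close>.
\<close>

primrec cop_iter :: "('k::field \<Rightarrow> 'h \<Rightarrow> 'h::ring_1) \<Rightarrow> ('h \<Rightarrow> ('h list \<Rightarrow>\<^sub>0 'k)) \<Rightarrow> ('h \<Rightarrow> 'k) \<Rightarrow>
    nat \<Rightarrow> 'h \<Rightarrow> ('h list \<Rightarrow>\<^sub>0 'k)" where
  "cop_iter sH cop eps 0 h = fscale (eps h) (pure sH [])"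
| "cop_iter sH cop eps (Suc n) h =
     lin_ext fscale (\<lambda>p. tconc sH (pure sH [p ! 0]) (cop_iter sH cop eps n (p ! 1))) (cop h)"

definition tact :: "('k::field \<Rightarrow> 'h \<Rightarrow> 'h::ring_1) \<Rightarrow> ('h \<Rightarrow> ('h list \<Rightarrow>\<^sub>0 'k)) \<Rightarrow> ('h \<Rightarrow> 'k) \<Rightarrow>
    nat \<Rightarrow> ('h list \<Rightarrow>\<^sub>0 'k) \<Rightarrow> 'h \<Rightarrow> ('h list \<Rightarrow>\<^sub>0 'k)" where
  "tact sH cop eps n u h = tmul sH u (cop_iter sH cop eps n h)"

locale left_module = vector_space sV
  for sH :: "'k::field \<Rightarrow> 'h::ring_1 \<Rightarrow> 'h"
    and sV :: "'k \<Rightarrow> 'v::ab_group_add \<Rightarrow> 'v" +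
  fixes act :: "'h \<Rightarrow> 'v \<Rightarrow> 'v"
  assumes act_add_left: "act (g + h) v = act g v + act h v"
    and act_add_right: "act h (v + w) = act h v + act h w"
    and act_scale_left: "act (sH c h) v = sV c (act h v)"
    and act_scale_right: "act h (sV c v) = sV c (act h v)"
    and act_one: "act 1 v = v"
    and act_mult: "act (g * h) v = act g (act h v)"

locale right_module = vector_space sV
  for sH :: "'k::field \<Rightarrow> 'h::ring_1 \<Rightarrow> 'h"
    and sV :: "'k \<Rightarrow> 'v::ab_group_add \<Rightarrow> 'v" +
  fixes ract :: "'v \<Rightarrow> 'h \<Rightarrow> 'v"
  assumes ract_add_left: "ract (v + w) h = ract v h + ract w h"
    and ract_add_right: "ract v (g + h) = ract v g + ract v h"
    and ract_scale_left: "ract (sV c v) h = sV c (ract v h)"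
    and ract_scale_right: "ract v (sH c h) = sV c (ract v h)"
    and ract_one: "ract v 1 = v"
    and ract_mult: "ract v (g * h) = ract (ract v g) h"

text \<open>
  An \<open>H\<close>-bimodule \<open>Y\<close> that is a commutative associative \<open>H\<close>-differential algebra for both actions.
  The algebra \<open>Y\<close> is not required to have a unit.
\<close>

locale differential_bimodule_algebra =
    left_module sH sY lact + right_module sH sY ract
  for sH :: "'k::field \<Rightarrow> 'h::ring_1 \<Rightarrow> 'h"
    and cop :: "'h \<Rightarrow> ('h list \<Rightarrow>\<^sub>0 'k)"
    and sY :: "'k \<Rightarrow> 'y::comm_ring \<Rightarrow> 'y"
    and lact :: "'h \<Rightarrow> 'y \<Rightarrow> 'y" and ract :: "'y \<Rightarrow> 'h \<Rightarrow> 'y" +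
  assumes bimodule: "ract (lact g y) h = lact g (ract y h)"
    and scale_mult: "sY c (y * z) = sY c y * z"
    and lact_mult: "lact h (y * z) = lin_ext sY (\<lambda>p. lact (p ! 0) y * lact (p ! 1) z) (cop h)"
    and ract_mult: "ract (y * z) h = lin_ext sY (\<lambda>p. ract y (p ! 0) * ract z (p ! 1)) (cop h)"


section \<open>Tensor products over \<open>H\<close>\<close>

text \<open>
  For a right module with carrier \<open>C\<close>, scalar multiplication \<open>sM\<close> and right action \<open>r\<close>, and a left
  module with scalar multiplication \<open>sL\<close> and action \<open>a\<close>.
\<close>

definition bal_rel :: "('k::field \<Rightarrow> 'm \<Rightarrow> 'm::ab_group_add) \<Rightarrow> 'm set \<Rightarrow> ('m \<Rightarrow> 'h \<Rightarrow> 'm) \<Rightarrow>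
    ('k \<Rightarrow> 'l \<Rightarrow> 'l::ab_group_add) \<Rightarrow> ('h \<Rightarrow> 'l \<Rightarrow> 'l) \<Rightarrow> ('m \<times> 'l \<Rightarrow>\<^sub>0 'k) set" where
  "bal_rel sM C r sL a =
     {gen (m + m', x) - gen (m, x) - gen (m', x) | m m' x. m \<in> C \<and> m' \<in> C} \<union>
     {gen (m, x + x') - gen (m, x) - gen (m, x') | m x x'. m \<in> C} \<union>
     {gen (sM c m, x) - fscale c (gen (m, x)) | c m x. m \<in> C} \<union>
     {gen (m, sL c x) - fscale c (gen (m, x)) | c m x. m \<in> C} \<union>
     {gen (r m h, x) - gen (m, a h x) | m h x. m \<in> C}"

definition btens :: "('k::field \<Rightarrow> 'm \<Rightarrow> 'm::ab_group_add) \<Rightarrow> 'm set \<Rightarrow> ('m \<Rightarrow> 'h \<Rightarrow> 'm) \<Rightarrow>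
    ('k \<Rightarrow> 'l \<Rightarrow> 'l::ab_group_add) \<Rightarrow> ('h \<Rightarrow> 'l \<Rightarrow> 'l) \<Rightarrow> 'm \<Rightarrow> 'l \<Rightarrow> ('m \<times> 'l \<Rightarrow>\<^sub>0 'k)" where
  "btens sM C r sL a m x = quot_map (bal_rel sM C r sL a) (gen (m, x))"

text \<open>
  The image of \<open>C \<otimes> D\<close> in the tensor product; the whole tensor product is obtained for \<open>D = UNIV\<close>,
  and its graded components by taking for \<open>D\<close> those of the left module.
\<close>

definition bspace :: "('k::field \<Rightarrow> 'm \<Rightarrow> 'm::ab_group_add) \<Rightarrow> 'm set \<Rightarrow> ('m \<Rightarrow> 'h \<Rightarrow> 'm) \<Rightarrow>
    ('k \<Rightarrow> 'l \<Rightarrow> 'l::ab_group_add) \<Rightarrow> ('h \<Rightarrow> 'l \<Rightarrow> 'l) \<Rightarrow> 'l set \<Rightarrow> ('m \<times> 'l \<Rightarrow>\<^sub>0 'k) set" where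
  "bspace sM C r sL a D = free.span {btens sM C r sL a m x | m x. m \<in> C \<and> x \<in> D}"

text \<open>The map \<open>f \<otimes>\<^sub>H 1\<close>, for \<open>f\<close> a right \<open>H\<close>-linear endomorphism of \<open>C\<close>.\<close>

definition bmap :: "('k::field \<Rightarrow> 'm \<Rightarrow> 'm::ab_group_add) \<Rightarrow> 'm set \<Rightarrow> ('m \<Rightarrow> 'h \<Rightarrow> 'm) \<Rightarrow>
    ('k \<Rightarrow> 'l \<Rightarrow> 'l::ab_group_add) \<Rightarrow> ('h \<Rightarrow> 'l \<Rightarrow> 'l) \<Rightarrow> ('m \<Rightarrow> 'm) \<Rightarrow>
    ('m \<times> 'l \<Rightarrow>\<^sub>0 'k) \<Rightarrow> ('m \<times> 'l \<Rightarrow>\<^sub>0 'k)" where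
  "bmap sM C r sL a f v = lin_ext fscale (\<lambda>(m, x). btens sM C r sL a (f m) x) v"


section \<open>Graded spaces, signs and shuffles\<close>

definition graded_space :: "('k::field \<Rightarrow> 'v \<Rightarrow> 'v::ab_group_add) \<Rightarrow> 'v set \<Rightarrow> (int \<Rightarrow> 'v set) \<Rightarrow> bool" where
  "graded_space s C G \<longleftrightarrow>
     (\<forall>n. module.subspace s (G n)) \<and> C = module.span s (\<Union>n. G n) \<and>
     (\<forall>I v. finite I \<longrightarrow> (\<forall>n\<in>I. v n \<in> G n) \<longrightarrow> (\<Sum>n\<in>I. v n) = 0 \<longrightarrow> (\<forall>n\<in>I. v n = 0))"

text \<open>\<open>b\<close> encodes a family of \<open>k\<close>-ary maps \<open>C\<^bsup>k\<^esup> \<rightarrow> D\<close>, \<open>k \<ge> 1\<close>, where \<open>k\<close> is the length of the argument.\<close>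

definition multilinear_family :: "('k::field \<Rightarrow> 'v \<Rightarrow> 'v::ab_group_add) \<Rightarrow> 'v set \<Rightarrow>
    ('k \<Rightarrow> 'w \<Rightarrow> 'w::ab_group_add) \<Rightarrow> (nat \<Rightarrow> 'w set) \<Rightarrow> ('v list \<Rightarrow> 'w) \<Rightarrow> bool" where
  "multilinear_family s C s' D b \<longleftrightarrow>
     (\<forall>xs. xs \<noteq> [] \<longrightarrow> set xs \<subseteq> C \<longrightarrow> b xs \<in> D (length xs)) \<and>
     (\<forall>xs ys u v. set xs \<union> set ys \<union> {u, v} \<subseteq> C \<longrightarrow>
        b (xs @ (u + v) # ys) = b (xs @ u # ys) + b (xs @ v # ys)) \<and>
     (\<forall>xs ys u c. set xs \<union> set ys \<union> {u} \<subseteq> C \<longrightarrow> b (xs @ s c u # ys) = s' c (b (xs @ u # ys)))"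

definition homogeneous :: "(int \<Rightarrow> 'v set) \<Rightarrow> int list \<Rightarrow> 'v list \<Rightarrow> bool" where
  "homogeneous G ds xs \<longleftrightarrow> list_all2 (\<lambda>d x. x \<in> G d) ds xs"

text \<open>
  The Koszul sign of \<open>(x\<^sub>1, \<dots>, x\<^sub>N) \<mapsto> (x\<^bsub>\<sigma>(1)\<^esub>, \<dots>, x\<^bsub>\<sigma>(N)\<^esub>)\<close> for \<open>x\<^sub>i\<close> of degree \<open>ds ! i\<close>: a factor \<open>-1\<close>
  for each pair of odd elements whose order is reversed.
\<close>

definition koszul_sign :: "int list \<Rightarrow> (nat \<Rightarrow> nat) \<Rightarrow> int" where
  "koszul_sign ds \<sigma> =
     (\<Prod>(i, j) | i < j \<and> j < length ds \<and> \<sigma> j < \<sigma> i.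
        if odd (ds ! \<sigma> i) \<and> odd (ds ! \<sigma> j) then - 1 else 1)"

definition shuffles_on :: "nat \<Rightarrow> nat \<Rightarrow> (nat \<Rightarrow> nat) set" where
  "shuffles_on l m =
     {\<sigma>. \<sigma> permutes {..<l + m} \<and> strict_mono_on {..<l} \<sigma> \<and> strict_mono_on {l..<l + m} \<sigma>}"

definition sscale :: "('k::field \<Rightarrow> 'v \<Rightarrow> 'v) \<Rightarrow> int \<Rightarrow> 'v \<Rightarrow> 'v" where
  "sscale s n v = s (of_int n) v"


section \<open>\<open>L\<^sub>\<infinity>\<close> algebras\<close>

text \<open>
  In the identity for given \<open>N = k + l - 1\<close>, the sum over \<open>k\<close> and \<open>l\<close> is written as a sum over
  \<open>l \<in> {1..N}\<close>, so that \<open>k - 1 = N - l\<close>. The space is a subspace \<open>C\<close> of the ambient type.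
\<close>

locale L_infty_algebra = vector_space s
  for s :: "'k::field \<Rightarrow> 'v::ab_group_add \<Rightarrow> 'v" +
  fixes C :: "'v set" and G :: "int \<Rightarrow> 'v set" and b :: "'v list \<Rightarrow> 'v"
  assumes graded: "graded_space s C G"
    and multilinear: "multilinear_family s C s (\<lambda>k. C) b"
    and degree: "xs \<noteq> [] \<Longrightarrow> homogeneous G ds xs \<Longrightarrow>
      b xs \<in> G (sum_list ds + int (length xs) - 2)"
    and skew_symmetric: "xs \<noteq> [] \<Longrightarrow> homogeneous G ds xs \<Longrightarrow> \<sigma> permutes {..<length xs} \<Longrightarrow>
      b xs = sscale s (sign \<sigma> * koszul_sign ds \<sigma>) (b (permute_list \<sigma> xs))"
    and jacobi: "xs \<noteq> [] \<Longrightarrow> homogeneous G ds xs \<Longrightarrow>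
      (\<Sum>l = 1..length xs. \<Sum>\<sigma>\<in>shuffles_on l (length xs - l).
         sscale s (sign \<sigma> * koszul_sign ds \<sigma> * (- 1) ^ (l * (length xs - l)))
           (b (b (take l (permute_list \<sigma> xs)) # drop l (permute_list \<sigma> xs)))) = 0"


section \<open>\<open>L\<^sub>\<infinity>\<close> \<open>H\<close>-pseudoalgebras\<close>

text \<open>The element \<open>u \<otimes>\<^sub>H x\<close> of \<open>H\<^bsup>\<otimes>n\<^esup> \<otimes>\<^sub>H L\<close>.\<close>

abbreviation ptens :: "('k::field \<Rightarrow> 'h \<Rightarrow> 'h::ring_1) \<Rightarrow> ('h \<Rightarrow> ('h list \<Rightarrow>\<^sub>0 'k)) \<Rightarrow> ('h \<Rightarrow> 'k) \<Rightarrow>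
    ('k \<Rightarrow> 'l \<Rightarrow> 'l::ab_group_add) \<Rightarrow> ('h \<Rightarrow> 'l \<Rightarrow> 'l) \<Rightarrow>
    nat \<Rightarrow> ('h list \<Rightarrow>\<^sub>0 'k) \<Rightarrow> 'l \<Rightarrow> (('h list \<Rightarrow>\<^sub>0 'k) \<times> 'l \<Rightarrow>\<^sub>0 'k)" where
  "ptens sH cop eps sL act n \<equiv> btens fscale (tpow sH n) (tact sH cop eps n) sL act"

abbreviation pspace :: "('k::field \<Rightarrow> 'h \<Rightarrow> 'h::ring_1) \<Rightarrow> ('h \<Rightarrow> ('h list \<Rightarrow>\<^sub>0 'k)) \<Rightarrow> ('h \<Rightarrow> 'k) \<Rightarrow>
    ('k \<Rightarrow> 'l \<Rightarrow> 'l::ab_group_add) \<Rightarrow> ('h \<Rightarrow> 'l \<Rightarrow> 'l) \<Rightarrow>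
    nat \<Rightarrow> 'l set \<Rightarrow> (('h list \<Rightarrow>\<^sub>0 'k) \<times> 'l \<Rightarrow>\<^sub>0 'k) set" where
  "pspace sH cop eps sL act n \<equiv> bspace fscale (tpow sH n) (tact sH cop eps n) sL act"

abbreviation pmap :: "('k::field \<Rightarrow> 'h \<Rightarrow> 'h::ring_1) \<Rightarrow> ('h \<Rightarrow> ('h list \<Rightarrow>\<^sub>0 'k)) \<Rightarrow> ('h \<Rightarrow> 'k) \<Rightarrow>
    ('k \<Rightarrow> 'l \<Rightarrow> 'l::ab_group_add) \<Rightarrow> ('h \<Rightarrow> 'l \<Rightarrow> 'l) \<Rightarrow>
    nat \<Rightarrow> (('h list \<Rightarrow>\<^sub>0 'k) \<Rightarrow> ('h list \<Rightarrow>\<^sub>0 'k)) \<Rightarrow>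
    (('h list \<Rightarrow>\<^sub>0 'k) \<times> 'l \<Rightarrow>\<^sub>0 'k) \<Rightarrow> (('h list \<Rightarrow>\<^sub>0 'k) \<times> 'l \<Rightarrow>\<^sub>0 'k)" where
  "pmap sH cop eps sL act n \<equiv> bmap fscale (tpow sH n) (tact sH cop eps n) sL act"

text \<open>
  \<open>pcomp \<dots> \<phi> l v xs\<close> is \<open>\<phi>(v, xs)\<close> for \<open>v \<in> H\<^bsup>\<otimes>l\<^esup> \<otimes>\<^sub>H L\<close>: if \<open>v\<close> is the sum of \<open>h\<^sub>i \<otimes>\<^sub>H e\<^sub>i\<close> with
  \<open>h\<^sub>i \<in> H\<^bsup>\<otimes>l\<^esup>\<close> and \<open>\<phi>(e\<^sub>i, xs)\<close> is the sum of \<open>(f\<^sup>1 \<otimes> \<dots> \<otimes> f\<^sup>k) \<otimes>\<^sub>H e\<^sub>i\<^sub>j\<close>, then it is the sum of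
  \<open>(h\<^sub>i f\<^sup>1 \<otimes> f\<^sup>2 \<otimes> \<dots> \<otimes> f\<^sup>k) \<otimes>\<^sub>H e\<^sub>i\<^sub>j\<close>, where \<open>h\<^sub>i f\<^sup>1\<close> uses the right action of \<open>H\<close> on \<open>H\<^bsup>\<otimes>l\<^esup>\<close>.
\<close>

definition pcomp :: "('k::field \<Rightarrow> 'h \<Rightarrow> 'h::ring_1) \<Rightarrow> ('h \<Rightarrow> ('h list \<Rightarrow>\<^sub>0 'k)) \<Rightarrow> ('h \<Rightarrow> 'k) \<Rightarrow>
    ('k \<Rightarrow> 'l \<Rightarrow> 'l::ab_group_add) \<Rightarrow> ('h \<Rightarrow> 'l \<Rightarrow> 'l) \<Rightarrow>
    ('l list \<Rightarrow> (('h list \<Rightarrow>\<^sub>0 'k) \<times> 'l \<Rightarrow>\<^sub>0 'k)) \<Rightarrow> nat \<Rightarrow>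
    (('h list \<Rightarrow>\<^sub>0 'k) \<times> 'l \<Rightarrow>\<^sub>0 'k) \<Rightarrow> 'l list \<Rightarrow> (('h list \<Rightarrow>\<^sub>0 'k) \<times> 'l \<Rightarrow>\<^sub>0 'k)" where
  "pcomp sH cop eps sL act \<phi> l v xs =
     lin_ext fscale (\<lambda>(u, e).
       lin_ext fscale (\<lambda>(w, e').
         ptens sH cop eps sL act (l + length xs)
           (lin_ext fscale (\<lambda>fs. tconc sH (tact sH cop eps l u (hd fs)) (pure sH (tl fs))) w) e')
       (\<phi> (e # xs))) v"

locale L_infty_pseudoalgebra = left_module sH sL act
  for sH :: "'k::field \<Rightarrow> 'h::ring_1 \<Rightarrow> 'h"
    and cop :: "'h \<Rightarrow> ('h list \<Rightarrow>\<^sub>0 'k)" and eps :: "'h \<Rightarrow> 'k"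
    and sL :: "'k \<Rightarrow> 'l::ab_group_add \<Rightarrow> 'l" and act :: "'h \<Rightarrow> 'l \<Rightarrow> 'l" +
  fixes G :: "int \<Rightarrow> 'l set"
    and \<beta> :: "'l list \<Rightarrow> (('h list \<Rightarrow>\<^sub>0 'k) \<times> 'l \<Rightarrow>\<^sub>0 'k)"
  assumes graded: "graded_space sL UNIV G"
    and graded_act: "x \<in> G n \<Longrightarrow> act h x \<in> G n"
    and multilinear: "multilinear_family sL UNIV fscale (\<lambda>k. pspace sH cop eps sL act k UNIV) \<beta>"
    and H_linear: "xs \<noteq> [] \<Longrightarrow> length hs = length xs \<Longrightarrow>
      \<beta> (map2 act hs xs) = pmap sH cop eps sL act (length xs) (tmul sH (pure sH hs)) (\<beta> xs)"
    and degree: "xs \<noteq> [] \<Longrightarrow> homogeneous G ds xs \<Longrightarrow>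
      \<beta> xs \<in> pspace sH cop eps sL act (length xs) (G (sum_list ds + int (length xs) - 2))"
    and skew_symmetric: "xs \<noteq> [] \<Longrightarrow> homogeneous G ds xs \<Longrightarrow> \<sigma> permutes {..<length xs} \<Longrightarrow>
      \<beta> xs = sscale fscale (sign \<sigma> * koszul_sign ds \<sigma>)
        (pmap sH cop eps sL act (length xs) (tperm sH \<sigma>) (\<beta> (permute_list \<sigma> xs)))"
    and jacobi: "xs \<noteq> [] \<Longrightarrow> homogeneous G ds xs \<Longrightarrow>
      (\<Sum>l = 1..length xs. \<Sum>\<sigma>\<in>shuffles_on l (length xs - l).
         sscale fscale (sign \<sigma> * koszul_sign ds \<sigma> * (- 1) ^ (l * (length xs - l)))
           (pmap sH cop eps sL act (length xs) (tperm sH \<sigma>)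
             (pcomp sH cop eps sL act \<beta> l (\<beta> (take l (permute_list \<sigma> xs)))
               (drop l (permute_list \<sigma> xs))))) = 0"


section \<open>Annihilation algebras\<close>

abbreviation annih_tens :: "('k::field \<Rightarrow> 'y \<Rightarrow> 'y::comm_ring) \<Rightarrow> ('y \<Rightarrow> 'h \<Rightarrow> 'y) \<Rightarrow>
    ('k \<Rightarrow> 'l \<Rightarrow> 'l::ab_group_add) \<Rightarrow> ('h \<Rightarrow> 'l \<Rightarrow> 'l) \<Rightarrow> 'y \<Rightarrow> 'l \<Rightarrow> ('y \<times> 'l \<Rightarrow>\<^sub>0 'k)" where
  "annih_tens sY ract sL act \<equiv> btens sY UNIV ract sL act"

abbreviation annih_space :: "('k::field \<Rightarrow> 'y \<Rightarrow> 'y::comm_ring) \<Rightarrow> ('y \<Rightarrow> 'h \<Rightarrow> 'y) \<Rightarrow>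
    ('k \<Rightarrow> 'l \<Rightarrow> 'l::ab_group_add) \<Rightarrow> ('h \<Rightarrow> 'l \<Rightarrow> 'l) \<Rightarrow> ('y \<times> 'l \<Rightarrow>\<^sub>0 'k) set" where
  "annih_space sY ract sL act \<equiv> bspace sY UNIV ract sL act UNIV"

text \<open>As \<open>Y\<close> sits in degree \<open>0\<close>, the component of degree \<open>n\<close> of \<open>Y \<otimes>\<^sub>H L\<close> is \<open>Y \<otimes>\<^sub>H L\<^sup>n\<close>.\<close>

abbreviation annih_grading :: "('k::field \<Rightarrow> 'y \<Rightarrow> 'y::comm_ring) \<Rightarrow> ('y \<Rightarrow> 'h \<Rightarrow> 'y) \<Rightarrow>
    ('k \<Rightarrow> 'l \<Rightarrow> 'l::ab_group_add) \<Rightarrow> ('h \<Rightarrow> 'l \<Rightarrow> 'l) \<Rightarrow> (int \<Rightarrow> 'l set) \<Rightarrow>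
    int \<Rightarrow> ('y \<times> 'l \<Rightarrow>\<^sub>0 'k) set" where
  "annih_grading sY ract sL act G n \<equiv> bspace sY UNIV ract sL act (G n)"

abbreviation annih_act :: "('k::field \<Rightarrow> 'y \<Rightarrow> 'y::comm_ring) \<Rightarrow> ('h \<Rightarrow> 'y \<Rightarrow> 'y) \<Rightarrow> ('y \<Rightarrow> 'h \<Rightarrow> 'y) \<Rightarrow>
    ('k \<Rightarrow> 'l \<Rightarrow> 'l::ab_group_add) \<Rightarrow> ('h \<Rightarrow> 'l \<Rightarrow> 'l) \<Rightarrow>
    'h \<Rightarrow> ('y \<times> 'l \<Rightarrow>\<^sub>0 'k) \<Rightarrow> ('y \<times> 'l \<Rightarrow>\<^sub>0 'k)" where
  "annih_act sY lact ract sL act h \<equiv> bmap sY UNIV ract sL act (lact h)"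

text \<open>The product of a nonempty list; \<open>prod_list\<close> is not available since \<open>Y\<close> need not have a unit.\<close>

fun prod_nonempty :: "'y::semigroup_mult list \<Rightarrow> 'y" where
  "prod_nonempty [] = undefined"
| "prod_nonempty [y] = y"
| "prod_nonempty (y # z # ys) = y * prod_nonempty (z # ys)"

text \<open>\<open>b\<close> is the family of multilinear maps given on generators by the formula for \<open>\<beta>\<^sub>k\<close> tilde.\<close>

definition annih_bracket :: "('k::field \<Rightarrow> 'h \<Rightarrow> 'h::ring_1) \<Rightarrow> ('h \<Rightarrow> ('h list \<Rightarrow>\<^sub>0 'k)) \<Rightarrow> ('h \<Rightarrow> 'k) \<Rightarrow>
    ('k \<Rightarrow> 'y \<Rightarrow> 'y::comm_ring) \<Rightarrow> ('y \<Rightarrow> 'h \<Rightarrow> 'y) \<Rightarrow>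
    ('k \<Rightarrow> 'l \<Rightarrow> 'l::ab_group_add) \<Rightarrow> ('h \<Rightarrow> 'l \<Rightarrow> 'l) \<Rightarrow>
    ('l list \<Rightarrow> (('h list \<Rightarrow>\<^sub>0 'k) \<times> 'l \<Rightarrow>\<^sub>0 'k)) \<Rightarrow>
    (('y \<times> 'l \<Rightarrow>\<^sub>0 'k) list \<Rightarrow> ('y \<times> 'l \<Rightarrow>\<^sub>0 'k)) \<Rightarrow> bool" where
  "annih_bracket sH cop eps sY ract sL act \<beta> b \<longleftrightarrow>
     multilinear_family fscale (annih_space sY ract sL act) fscale (\<lambda>k. annih_space sY ract sL act) b \<and>
     (\<forall>ys xs ts. xs \<noteq> [] \<longrightarrow> length ys = length xs \<longrightarrow>
        (\<forall>(fs, e)\<in>set ts. length fs = length xs) \<longrightarrow>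
        \<beta> xs = (\<Sum>(fs, e)\<leftarrow>ts. ptens sH cop eps sL act (length xs) (pure sH fs) e) \<longrightarrow>
        b (map2 (annih_tens sY ract sL act) ys xs) =
          (\<Sum>(fs, e)\<leftarrow>ts. annih_tens sY ract sL act (prod_nonempty (map2 ract ys fs)) e))"

end

theory Submission
  imports Defs
begin

text \<open>
  For \<open>y\<^sub>1, \<dots>, y\<^sub>n \<in> Y\<close> the map \<open>f\<^sub>1 \<otimes> \<dots> \<otimes> f\<^sub>n \<mapsto> (y\<^sub>1 f\<^sub>1) \<cdots> (y\<^sub>n f\<^sub>n)\<close> from \<open>H\<^bsup>\<otimes>n\<^esup>\<close> to \<open>Y\<close> is right
  \<open>H\<close>-linear by the Leibniz rule, so it induces an evaluation \<open>H\<^bsup>\<otimes>n\<^esup> \<otimes>\<^sub>H L \<rightarrow> Y \<otimes>\<^sub>H L\<close>, and the bracket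
  of the \<open>y\<^sub>i \<otimes>\<^sub>H x\<^sub>i\<close> is the evaluation of \<open>\<beta>(x\<^sub>1, \<dots>, x\<^sub>n)\<close>. Commutativity of \<open>Y\<close> turns \<open>P\<^sub>\<sigma>\<close> into the
  permutation of the \<open>y\<^sub>i\<close>, and \<open>H\<close>-linearity turns the composition of the \<open>\<beta>\<^sub>k\<close> into the composition of
  brackets. Every identity is multilinear, so it suffices to check it on tensors \<open>y \<otimes>\<^sub>H x\<close> with \<open>x\<close>
  homogeneous, where it is the evaluation of the corresponding identity of the pseudoalgebra.

  As quotients are realised on complements inside free spaces, induced maps are linear extensions
  applied to representatives.
\<close>

section \<open>Linear extensions and quotients\<close>

context vector_space
begin

text \<open>Coefficients vanish outside the support. A common index set is what additivity needs,
  since two elements may have different supports and terms of their sum may cancel.\<close>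

lemma lin_ext_superset:
  assumes "finite A" "Poly_Mapping.keys u \<subseteq> A"
  shows "lin_ext scale f u = (\<Sum>b\<in>A. scale (Poly_Mapping.lookup u b) (f b))"
  unfolding lin_ext_def
  by (rule sum.mono_neutral_left) (use assms in \<open>auto simp: in_keys_iff\<close>)

lemma lin_ext_add: "lin_ext scale f (u + v) = lin_ext scale f u + lin_ext scale f v"
proof -
  let ?A = "Poly_Mapping.keys u \<union> Poly_Mapping.keys v"
  have "Poly_Mapping.keys (u + v) \<subseteq> ?A"
    by (rule Poly_Mapping.keys_add)
  then show ?thesis
    by (simp add: lin_ext_superset[of ?A] lookup_add scale_left_distrib sum.distrib)
qed

lemma lin_ext_fscale: "lin_ext scale f (fscale c u) = scale c (lin_ext scale f u)"
proof -
  have "Poly_Mapping.keys (fscale c u) \<subseteq> Poly_Mapping.keys u"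
    by (auto simp: in_keys_iff lookup_fscale)
  then show ?thesis
    by (simp add: lin_ext_superset[of "Poly_Mapping.keys u"] lookup_fscale scale_sum_right)
qed

lemma linear_lin_ext: "Vector_Spaces.linear fscale scale (lin_ext scale f)"
  by unfold_locales (simp_all add: lin_ext_add lin_ext_fscale)

lemma lin_ext_zero [simp]: "lin_ext scale f 0 = 0"
  by (simp add: lin_ext_def)

lemma lin_ext_diff: "lin_ext scale f (u - v) = lin_ext scale f u - lin_ext scale f v"
  by (metis add_diff_cancel_right' diff_add_cancel lin_ext_add)

lemma lin_ext_gen [simp]: "lin_ext scale f (gen b) = f b"
  by (simp add: lin_ext_def gen_def)

lemma lin_ext_add_fun: "lin_ext scale (\<lambda>b. f b + g b) u = lin_ext scale f u + lin_ext scale g u"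
  by (simp add: lin_ext_def scale_right_distrib sum.distrib)

lemma lin_ext_scale_fun: "lin_ext scale (\<lambda>b. scale c (f b)) u = scale c (lin_ext scale f u)"
  by (simp add: lin_ext_def scale_sum_right mult.commute)

lemma lin_ext_zero_fun [simp]: "lin_ext scale (\<lambda>b. 0) u = 0"
  by (simp add: lin_ext_def)

lemma lin_ext_swap:
  "lin_ext scale (\<lambda>a. lin_ext scale (f a) v) u = lin_ext scale (\<lambda>b. lin_ext scale (\<lambda>a. f a b) u) v"
  unfolding lin_ext_def scale_sum_right
  by (subst sum.swap) (simp add: mult.commute)

lemma lin_ext_in_subspace:
  assumes "subspace W" "\<And>b. b \<in> Poly_Mapping.keys u \<Longrightarrow> f b \<in> W"
  shows "lin_ext scale f u \<in> W"
  unfolding lin_ext_def by (intro subspace_sum subspace_scale assms)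

lemma lin_ext_span_eq_0:
  assumes "\<And>r. r \<in> R \<Longrightarrow> lin_ext scale f r = 0" "u \<in> free.span R"
  shows "lin_ext scale f u = 0"
  using assms(2)
  by (induction rule: free.span_induct_alt) (auto simp: lin_ext_add lin_ext_fscale assms(1))

end

lemma lin_ext_cong:
  "(\<And>b. b \<in> Poly_Mapping.keys u \<Longrightarrow> f b = g b) \<Longrightarrow> lin_ext s f u = lin_ext s g u"
  by (simp add: lin_ext_def)

lemma linear_lin_ext_comp:
  assumes "Vector_Spaces.linear s1 s2 L"
  shows "L (lin_ext s1 f u) = lin_ext s2 (\<lambda>b. L (f b)) u"
proof -
  interpret Vector_Spaces.linear s1 s2 L by fact
  show ?thesis by (simp add: lin_ext_def sum scale)
qed

lemma (in vector_space) lin_ext_comp: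
  "lin_ext scale f (lin_ext fscale g u) = lin_ext scale (\<lambda>b. lin_ext scale f (g b)) u"
  by (rule linear_lin_ext_comp[OF linear_lin_ext])

lemma linear_quot_map: "Vector_Spaces.linear fscale fscale (quot_map R)"
  and quot_map_idem: "quot_map R (quot_map R u) = quot_map R u"
  and quot_map_eq_0_iff: "quot_map R u = 0 \<longleftrightarrow> u \<in> free.span R"
  using is_quot_map_quot_map[of R] by (auto simp: is_quot_map_def)

lemma quot_map_diff: "quot_map R (u - v) = quot_map R u - quot_map R v"
  and quot_map_fscale: "quot_map R (fscale c u) = fscale c (quot_map R u)"
proof -
  interpret Vector_Spaces.linear fscale fscale "quot_map R" by (rule linear_quot_map)
  show "quot_map R (u - v) = quot_map R u - quot_map R v"
    "quot_map R (fscale c u) = fscale c (quot_map R u)"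
    by (simp_all add: diff scale)
qed

lemma quot_map_rel: "r \<in> R \<Longrightarrow> quot_map R r = 0"
  by (simp add: quot_map_eq_0_iff free.span_base)

lemma quot_map_diff_in_span: "quot_map R u - u \<in> free.span R"
  by (simp flip: quot_map_eq_0_iff add: quot_map_diff quot_map_idem)

text \<open>The representative chosen by \<open>quot_map R\<close> differs from \<open>u\<close> by
  an element of the span of \<open>R\<close>, which is killed. This is how induced maps on quotients
  are evaluated throughout.\<close>

lemma (in vector_space) lin_ext_quot_map:
  assumes "\<And>r. r \<in> R \<Longrightarrow> lin_ext scale f r = 0"
  shows "lin_ext scale f (quot_map R u) = lin_ext scale f u"
  using lin_ext_span_eq_0[of R f, OF assms quot_map_diff_in_span[of R u]]
  by (simp add: lin_ext_diff)

lemma subspace_keys: "free.subspace {u. Poly_Mapping.keys u \<subseteq> S}"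
proof (rule free.subspaceI)
  show "u + v \<in> {u. Poly_Mapping.keys u \<subseteq> S}"
    if "u \<in> {u. Poly_Mapping.keys u \<subseteq> S}" "v \<in> {u. Poly_Mapping.keys u \<subseteq> S}" for u v
    using that Poly_Mapping.keys_add[of u v] by blast
qed (auto simp: in_keys_iff lookup_fscale)

lemma keys_diff_subset:
  "Poly_Mapping.keys u \<subseteq> S \<Longrightarrow> Poly_Mapping.keys v \<subseteq> S \<Longrightarrow> Poly_Mapping.keys (u - v) \<subseteq> S"
  for u v :: "'b \<Rightarrow>\<^sub>0 'k::field"
  using free.subspace_diff[OF subspace_keys[of S], of u v] by simp

lemma keys_fscale_subset: "Poly_Mapping.keys u \<subseteq> S \<Longrightarrow> Poly_Mapping.keys (fscale c u) \<subseteq> S"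
  using free.subspace_scale[OF subspace_keys[of S], of u c] by simp

lemma keys_gen_subset: "b \<in> S \<Longrightarrow> Poly_Mapping.keys (gen b) \<subseteq> S"
  by (simp add: gen_def)

lemma keys_span_subset:
  assumes "\<And>r. r \<in> R \<Longrightarrow> Poly_Mapping.keys r \<subseteq> S" "u \<in> free.span R"
  shows "Poly_Mapping.keys u \<subseteq> S"
  using free.span_minimal[of R "{u. Poly_Mapping.keys u \<subseteq> S}"] assms subspace_keys[of S] by auto

text \<open>The representative is the generator plus a combination of relations, so its support
  cannot leave a set containing both. This controls list lengths and carriers although the
  representative itself is chosen arbitrarily.\<close>

lemma keys_quot_map_gen:
  assumes "\<And>r. r \<in> R \<Longrightarrow> Poly_Mapping.keys r \<subseteq> S" "b \<in> S"
  shows "Poly_Mapping.keys (quot_map R (gen b)) \<subseteq> S"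
proof -
  have "Poly_Mapping.keys (quot_map R (gen b) - gen b) \<subseteq> S"
    using keys_span_subset[OF assms(1) quot_map_diff_in_span] by blast
  moreover have "quot_map R (gen b) = (quot_map R (gen b) - gen b) + gen b" by simp
  ultimately show ?thesis
    using Poly_Mapping.keys_add[of "quot_map R (gen b) - gen b" "gen b"] keys_gen_subset[OF assms(2)] by auto
qed


section \<open>Tensor powers\<close>

lemma keys_pure: "Poly_Mapping.keys (pure s xs) \<subseteq> {ys. length ys = length xs}"
  unfolding pure_def
proof (rule keys_quot_map_gen)
  fix r assume "r \<in> tp_rel s (length xs)"
  then show "Poly_Mapping.keys r \<subseteq> {ys. length ys = length xs}"
    unfolding tp_rel_def
    by (elim UnE CollectE exE conjE)
      (simp_all add: keys_diff_subset keys_fscale_subset keys_gen_subset)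
qed simp

lemma pure_in_tpow: "length xs = n \<Longrightarrow> pure s xs \<in> tpow s n"
  unfolding tpow_def by (auto intro: free.span_base)

lemma subspace_tpow: "free.subspace (tpow s n)"
  unfolding tpow_def by (rule free.subspace_span)

lemma keys_tpow:
  assumes "u \<in> tpow s n" "xs \<in> Poly_Mapping.keys u"
  shows "length xs = n"
proof -
  have "Poly_Mapping.keys u \<subseteq> {xs. length xs = n}"
    using assms(1) unfolding tpow_def
    by (rule keys_span_subset[rotated]) (use keys_pure in blast)
  with assms(2) show ?thesis by blast
qed

text \<open>Universal property of the tensor power: the two hypotheses say that the linear extension
  of \<open>f\<close> kills both families of relations in \<open>tp_rel\<close>.\<close>

lemma (in vector_space) lin_ext_pure:
  assumes "\<And>us vs a b. length us + length vs + 1 = length xs \<Longrightarrow>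
      f (us @ (a + b) # vs) = f (us @ a # vs) + f (us @ b # vs)"
    and "\<And>us vs a c. length us + length vs + 1 = length xs \<Longrightarrow>
      f (us @ s c a # vs) = scale c (f (us @ a # vs))"
  shows "lin_ext scale f (pure s xs) = f xs"
proof -
  have "lin_ext scale f r = 0" if "r \<in> tp_rel s (length xs)" for r
    using that assms by (auto simp: tp_rel_def lin_ext_diff lin_ext_fscale)
  then show ?thesis
    unfolding pure_def by (simp add: lin_ext_quot_map)
qed

lemma tmul_in_tpow:
  assumes "u \<in> tpow s n" "v \<in> tpow s n"
  shows "tmul s u v \<in> tpow s n"
  unfolding tmul_def
  by (intro free.lin_ext_in_subspace subspace_tpow pure_in_tpow)
    (simp add: keys_tpow[OF assms(1)] keys_tpow[OF assms(2)])

lemma tconc_in_tpow: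
  assumes "u \<in> tpow s m" "v \<in> tpow s n"
  shows "tconc s u v \<in> tpow s (m + n)"
  unfolding tconc_def
  by (intro free.lin_ext_in_subspace subspace_tpow pure_in_tpow)
    (simp add: keys_tpow[OF assms(1)] keys_tpow[OF assms(2)])

lemma cop_iter_in_tpow: "cop_iter sH cop eps n h \<in> tpow sH n"
proof (induction n arbitrary: h)
  case 0
  show ?case
    by (simp add: free.subspace_scale[OF subspace_tpow] pure_in_tpow)
next
  case (Suc n)
  show ?case
    using tconc_in_tpow[OF pure_in_tpow[of _ 1 sH] Suc.IH]
    by (auto intro!: free.lin_ext_in_subspace subspace_tpow)
qed

lemma tact_in_tpow: "u \<in> tpow sH n \<Longrightarrow> tact sH cop eps n u h \<in> tpow sH n"
  unfolding tact_def by (intro tmul_in_tpow cop_iter_in_tpow)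


section \<open>Balanced tensor products\<close>

lemma btens_add_left:
  "m \<in> C \<Longrightarrow> m' \<in> C \<Longrightarrow> btens sM C r sL a (m + m') x = btens sM C r sL a m x + btens sM C r sL a m' x"
  and btens_add_right:
  "m \<in> C \<Longrightarrow> btens sM C r sL a m (x + x') = btens sM C r sL a m x + btens sM C r sL a m x'"
  and btens_scale_left:
  "m \<in> C \<Longrightarrow> btens sM C r sL a (sM c m) x = fscale c (btens sM C r sL a m x)"
  and btens_scale_right:
  "m \<in> C \<Longrightarrow> btens sM C r sL a m (sL c x) = fscale c (btens sM C r sL a m x)"
  and btens_balanced:
  "m \<in> C \<Longrightarrow> btens sM C r sL a (r m h) x = btens sM C r sL a m (a h x)"
proof -
  let ?R = "bal_rel sM C r sL a"
  have *: "quot_map ?R (u - v - w) = 0 \<Longrightarrow> quot_map ?R u = quot_map ?R v + quot_map ?R w" for u v w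
    by (simp add: quot_map_diff diff_eq_eq add.commute)
  have **: "quot_map ?R (u - v) = 0 \<Longrightarrow> quot_map ?R u = quot_map ?R v" for u v
    by (simp add: quot_map_diff)
  show "m \<in> C \<Longrightarrow> m' \<in> C \<Longrightarrow> btens sM C r sL a (m + m') x = btens sM C r sL a m x + btens sM C r sL a m' x"
    unfolding btens_def by (rule *, rule quot_map_rel, unfold bal_rel_def, rule UnI1, rule UnI1, rule UnI1, rule UnI1) blast
  show "m \<in> C \<Longrightarrow> btens sM C r sL a m (x + x') = btens sM C r sL a m x + btens sM C r sL a m x'"
    unfolding btens_def by (rule *, rule quot_map_rel, unfold bal_rel_def, rule UnI1, rule UnI1, rule UnI1, rule UnI2) blast
  show "m \<in> C \<Longrightarrow> btens sM C r sL a (sM c m) x = fscale c (btens sM C r sL a m x)"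
    unfolding btens_def quot_map_fscale[symmetric]
    by (rule **, rule quot_map_rel, unfold bal_rel_def, rule UnI1, rule UnI1, rule UnI2) blast
  show "m \<in> C \<Longrightarrow> btens sM C r sL a m (sL c x) = fscale c (btens sM C r sL a m x)"
    unfolding btens_def quot_map_fscale[symmetric]
    by (rule **, rule quot_map_rel, unfold bal_rel_def, rule UnI1, rule UnI2) blast
  show "m \<in> C \<Longrightarrow> btens sM C r sL a (r m h) x = btens sM C r sL a m (a h x)"
    unfolding btens_def by (rule **, rule quot_map_rel, unfold bal_rel_def, rule UnI2) blast
qed

lemma (in vector_space) lin_ext_bal_rel:
  assumes "\<And>m m' x. m \<in> C \<Longrightarrow> m' \<in> C \<Longrightarrow> f (m + m', x) = f (m, x) + f (m', x)"
    and "\<And>m x x'. m \<in> C \<Longrightarrow> f (m, x + x') = f (m, x) + f (m, x')"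
    and "\<And>c m x. m \<in> C \<Longrightarrow> f (sM c m, x) = scale c (f (m, x))"
    and "\<And>c m x. m \<in> C \<Longrightarrow> f (m, sL c x) = scale c (f (m, x))"
    and "\<And>m h x. m \<in> C \<Longrightarrow> f (r m h, x) = f (m, a h x)"
    and "q \<in> bal_rel sM C r sL a"
  shows "lin_ext scale f q = 0"
  using assms by (auto simp: bal_rel_def lin_ext_diff lin_ext_fscale)

text \<open>Universal property of the balanced tensor product: the hypotheses correspond to the five
  families of relations in \<open>bal_rel\<close>.\<close>

lemma (in vector_space) lin_ext_btens:
  assumes "\<And>m m' x. m \<in> C \<Longrightarrow> m' \<in> C \<Longrightarrow> f (m + m', x) = f (m, x) + f (m', x)"
    and "\<And>m x x'. m \<in> C \<Longrightarrow> f (m, x + x') = f (m, x) + f (m, x')"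
    and "\<And>c m x. m \<in> C \<Longrightarrow> f (sM c m, x) = scale c (f (m, x))"
    and "\<And>c m x. m \<in> C \<Longrightarrow> f (m, sL c x) = scale c (f (m, x))"
    and "\<And>m h x. m \<in> C \<Longrightarrow> f (r m h, x) = f (m, a h x)"
  shows "lin_ext scale f (btens sM C r sL a m x) = f (m, x)"
proof -
  have "lin_ext scale f q = 0" if "q \<in> bal_rel sM C r sL a" for q
    by (rule lin_ext_bal_rel[where C = C and f = f and sM = sM and sL = sL and r = r and a = a, OF assms that])
  then show ?thesis unfolding btens_def by (simp add: lin_ext_quot_map)
qed

lemma keys_btens:
  assumes "\<And>m m'. m \<in> C \<Longrightarrow> m' \<in> C \<Longrightarrow> m + m' \<in> C" "\<And>c m. m \<in> C \<Longrightarrow> sM c m \<in> C"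
    "\<And>m h. m \<in> C \<Longrightarrow> r m h \<in> C" "m \<in> C"
  shows "Poly_Mapping.keys (btens sM C r sL a m x) \<subseteq> C \<times> UNIV"
  unfolding btens_def
proof (rule keys_quot_map_gen)
  fix q assume "q \<in> bal_rel sM C r sL a"
  then show "Poly_Mapping.keys q \<subseteq> C \<times> UNIV"
    using assms(1-3) unfolding bal_rel_def
    by (elim UnE CollectE exE conjE)
      (simp_all add: keys_diff_subset keys_fscale_subset keys_gen_subset)
qed (use assms in auto)

lemma btens_in_bspace: "m \<in> C \<Longrightarrow> x \<in> D \<Longrightarrow> btens sM C r sL a m x \<in> bspace sM C r sL a D"
  unfolding bspace_def by (auto intro: free.span_base)

lemma subspace_bspace: "free.subspace (bspace sM C r sL a D)"
  unfolding bspace_def by (rule free.subspace_span)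

lemma bspace_mono: "D \<subseteq> D' \<Longrightarrow> bspace sM C r sL a D \<subseteq> bspace sM C r sL a D'"
  unfolding bspace_def by (rule free.span_mono) auto

lemma keys_bspace:
  assumes "\<And>m m'. m \<in> C \<Longrightarrow> m' \<in> C \<Longrightarrow> m + m' \<in> C" "\<And>c m. m \<in> C \<Longrightarrow> sM c m \<in> C"
    "\<And>m h. m \<in> C \<Longrightarrow> r m h \<in> C" "v \<in> bspace sM C r sL a D"
  shows "Poly_Mapping.keys v \<subseteq> C \<times> UNIV"
  using assms(4) unfolding bspace_def
proof (rule keys_span_subset[rotated])
  fix q assume "q \<in> {btens sM C r sL a m x |m x. m \<in> C \<and> x \<in> D}"
  then obtain m x where "q = btens sM C r sL a m x" "m \<in> C" by blast
  then show "Poly_Mapping.keys q \<subseteq> C \<times> UNIV"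
    using keys_btens[of C sM r m sL a x] assms(1-3) by blast
qed

text \<open>Guarantees that the first components occurring in a representative are genuine elements
  of the tensor power of \<open>H\<close>, so that facts about \<open>tpow\<close> apply term by
  term.\<close>

lemma keys_pspace:
  assumes "v \<in> pspace sH cop eps sL act n D" "(u, x) \<in> Poly_Mapping.keys v"
  shows "u \<in> tpow sH n"
proof -
  have "Poly_Mapping.keys v \<subseteq> tpow sH n \<times> UNIV"
    by (rule keys_bspace[OF _ _ _ assms(1)])
      (simp_all add: tact_in_tpow free.subspace_add[OF subspace_tpow] free.subspace_scale[OF subspace_tpow])
  with assms(2) show ?thesis by auto
qed


section \<open>Multilinear maps\<close>

text \<open>Unlike \<open>multilinear_family\<close>, this fixes the arity and speaks of list
  updates, which pass easily through \<open>map2\<close> and through permutations of the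
  arguments.\<close>

definition multilin :: "('k::field \<Rightarrow> 'v \<Rightarrow> 'v::ab_group_add) \<Rightarrow> 'v set \<Rightarrow>
    ('k \<Rightarrow> 'w \<Rightarrow> 'w::ab_group_add) \<Rightarrow> nat \<Rightarrow> ('v list \<Rightarrow> 'w) \<Rightarrow> bool" where
  "multilin s C s' n f \<longleftrightarrow>
     (\<forall>i<n. \<forall>vs. length vs = n \<longrightarrow> set vs \<subseteq> C \<longrightarrow>
        (\<forall>u\<in>C. \<forall>v\<in>C. f (vs[i := u + v]) = f (vs[i := u]) + f (vs[i := v])) \<and>
        (\<forall>u\<in>C. \<forall>c. f (vs[i := s c u]) = s' c (f (vs[i := u]))))"

lemma multilinear_family_multilin:
  assumes "multilinear_family s C s' D f"
  shows "multilin s C s' n f"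
proof -
  have a: "f (xs @ (u + v) # ys) = f (xs @ u # ys) + f (xs @ v # ys)"
    if "set xs \<union> set ys \<union> {u, v} \<subseteq> C" for xs ys u v
    using assms that by (simp add: multilinear_family_def)
  have b: "f (xs @ s c u # ys) = s' c (f (xs @ u # ys))"
    if "set xs \<union> set ys \<union> {u} \<subseteq> C" for xs ys u c
    using assms that by (simp add: multilinear_family_def)
  have "set (take i vs) \<subseteq> C" "set (drop (Suc i) vs) \<subseteq> C" if "set vs \<subseteq> C" for i vs
    using that set_take_subset set_drop_subset by fast+
  then show ?thesis
    unfolding multilin_def by (auto simp: upd_conv_take_nth_drop a b)
qed

context vector_space_pair
begin

lemma multilin_diff:
  "multilin s1 C s2 n f \<Longrightarrow> multilin s1 C s2 n g \<Longrightarrow> multilin s1 C s2 n (\<lambda>vs. f vs - g vs)"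
  by (simp add: multilin_def vs2.scale_right_diff_distrib)

lemma multilin_scale:
  "multilin s1 C s2 n f \<Longrightarrow> multilin s1 C s2 n (\<lambda>vs. s2 c (f vs))"
  by (simp add: multilin_def vs2.scale_right_distrib mult.commute)

lemma multilin_sum:
  "(\<And>i. i \<in> I \<Longrightarrow> multilin s1 C s2 n (f i)) \<Longrightarrow> multilin s1 C s2 n (\<lambda>vs. \<Sum>i\<in>I. f i vs)"
  by (simp add: multilin_def vs2.scale_sum_right sum.distrib)

text \<open>Extends a property from generators to spans one slot at a time. An arbitrary subspace
  \<open>W\<close> covers membership in a graded component, and \<open>W = {0}\<close> covers
  identities; the generating set may depend on the slot.\<close>

lemma multilin_subspace:
  assumes f: "multilin s1 C s2 n f" and W: "vs2.subspace W" and C: "vs1.subspace C"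
    and S: "\<And>i. i < n \<Longrightarrow> S i \<subseteq> C"
    and gens: "\<And>gs. length gs = n \<Longrightarrow> (\<And>i. i < n \<Longrightarrow> gs ! i \<in> S i) \<Longrightarrow> f gs \<in> W"
    and vs: "length vs = n" "\<And>i. i < n \<Longrightarrow> vs ! i \<in> vs1.span (S i)"
  shows "f vs \<in> W"
proof -
  have sp: "vs1.span (S i) \<subseteq> C" if "i < n" for i
    using vs1.span_minimal[OF S C] that by blast
  \<comment> \<open>The first \<open>k\<close> entries range over the spans while the others are
    still generators. Passing from \<open>k\<close> to \<open>Suc k\<close> is a second induction,
    over the span in slot \<open>k\<close>.\<close>
  have "f vs \<in> W" if "k \<le> n" "length vs = n" "\<And>i. i < k \<Longrightarrow> vs ! i \<in> vs1.span (S i)"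
      "\<And>i. k \<le> i \<Longrightarrow> i < n \<Longrightarrow> vs ! i \<in> S i" for k vs
    using that
  proof (induction k arbitrary: vs)
    case 0
    then show ?case by (intro gens) auto
  next
    case (Suc k)
    have len: "length vs = n" "k < n" using Suc.prems by auto
    have C': "set vs \<subseteq> C"
    proof
      fix v assume "v \<in> set vs"
      then obtain i where i: "i < n" "v = vs ! i" using len by (auto simp: in_set_conv_nth)
      then show "v \<in> C" using Suc.prems(3,4)[of i] sp[of i] S[of i] by (cases "i < Suc k") auto
    qed
    have add: "f (vs[k := u + v]) = f (vs[k := u]) + f (vs[k := v])" if "u \<in> C" "v \<in> C" for u v
      using f C' len that by (simp add: multilin_def)
    have scale: "f (vs[k := s1 c u]) = s2 c (f (vs[k := u]))" if "u \<in> C" for c u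
      using f C' len that by (simp add: multilin_def)
    have C0: "0 \<in> C" using C by (simp add: vs1.subspace_0)
    have "f (vs[k := 0]) = 0"
      using scale[OF C0, of 0] by simp
    have *: "w \<in> C \<and> f (vs[k := w]) \<in> W" if "w \<in> vs1.span (S k)" for w
      using that
    proof (induction rule: vs1.span_induct_alt)
      case base
      then show ?case using C0 \<open>f (vs[k := 0]) = 0\<close> vs2.subspace_0[OF W] by simp
    next
      case (step c x y)
      have x: "x \<in> C" using S[of k] step len by auto
      have "f (vs[k := x]) \<in> W"
        using Suc.prems step len by (intro Suc.IH) (auto simp: nth_list_update)
      then show ?case
        using step x vs1.subspace_add[OF C] vs1.subspace_scale[OF C]
        by (simp add: add scale vs2.subspace_add[OF W] vs2.subspace_scale[OF W])
    qed
    from *[of "vs ! k"] show ?case using Suc.prems len by simp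
  qed
  from this[of n vs] vs show ?thesis by simp
qed

end

interpretation free_pair: vector_space_pair
  "fscale :: 'k::field \<Rightarrow> ('b \<Rightarrow>\<^sub>0 'k) \<Rightarrow> _" "fscale :: 'k \<Rightarrow> ('c \<Rightarrow>\<^sub>0 'k) \<Rightarrow> _"
  by unfold_locales

section \<open>Multilinear extension from bases of free spaces\<close>

text \<open>Defining maps on the whole free space avoids choosing decompositions of the arguments;
  being well defined on a quotient then amounts to vanishing on relations in each slot.\<close>

primrec mlin_ext :: "('b list \<Rightarrow> ('c \<Rightarrow>\<^sub>0 'k::field)) \<Rightarrow> ('b \<Rightarrow>\<^sub>0 'k) list \<Rightarrow> ('c \<Rightarrow>\<^sub>0 'k)" where
  "mlin_ext f [] = f []"
| "mlin_ext f (v # vs) = lin_ext fscale (\<lambda>p. mlin_ext (\<lambda>ps. f (p # ps)) vs) v"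

lemma mlin_ext_add: "mlin_ext f (us @ (u + v) # vs) = mlin_ext f (us @ u # vs) + mlin_ext f (us @ v # vs)"
  by (induction us arbitrary: f) (simp_all add: free.lin_ext_add free.lin_ext_add_fun)

lemma mlin_ext_fscale: "mlin_ext f (us @ fscale c u # vs) = fscale c (mlin_ext f (us @ u # vs))"
  by (induction us arbitrary: f) (simp_all add: free.lin_ext_fscale free.lin_ext_scale_fun)

lemma mlin_ext_gen: "mlin_ext f (map gen ps) = f ps"
  by (induction ps arbitrary: f) simp_all

lemma mlin_ext_in_subspace:
  assumes "free.subspace W" "\<And>ps. length ps = length vs \<Longrightarrow> f ps \<in> W"
  shows "mlin_ext f vs \<in> W"
  using assms(2)
  by (induction vs arbitrary: f) (auto intro!: free.lin_ext_in_subspace assms(1))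

lemma mlin_ext_zero:
  assumes "\<And>ps. length ps = length vs \<Longrightarrow> f ps = 0"
  shows "mlin_ext f vs = 0"
  using mlin_ext_in_subspace[of "{0}", OF free.subspace_single_0] assms by blast

lemma lin_ext_mlin_ext:
  "lin_ext fscale (\<lambda>q. mlin_ext (f q) vs) r = mlin_ext (\<lambda>qs. lin_ext fscale (\<lambda>q. f q qs) r) vs"
proof (induction vs arbitrary: f)
  case (Cons v vs)
  show ?case
    by (simp add: free.lin_ext_swap[of _ v] Cons.IH)
qed simp

text \<open>The sums over the other slots commute with the linear extension in the distinguished
  slot, so the other arguments may be taken to be basis elements.\<close>

lemma mlin_ext_rel:
  assumes "\<And>ps qs. length ps = length us \<Longrightarrow> length qs = length vs \<Longrightarrow>
    lin_ext fscale (\<lambda>q. f (ps @ q # qs)) r = 0"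
  shows "mlin_ext f (us @ r # vs) = 0"
  using assms
proof (induction us arbitrary: f)
  case Nil
  then show ?case by (auto simp: lin_ext_mlin_ext intro!: mlin_ext_zero)
next
  case (Cons u us)
  have "mlin_ext (\<lambda>ps. f (p # ps)) (us @ r # vs) = 0" for p
    using Cons.prems[of "p # _"] by (intro Cons.IH) simp
  then show ?case by simp
qed

lemma mlin_ext_diff: "mlin_ext f (us @ (u - v) # vs) = mlin_ext f (us @ u # vs) - mlin_ext f (us @ v # vs)"
  by (metis add_diff_cancel_right' diff_add_cancel mlin_ext_add)

text \<open>The analogue of \<open>lin_ext_quot_map\<close> for several arguments.\<close>

lemma mlin_ext_quot_map_gen:
  assumes "\<And>ps qs r. length ps + length qs + 1 = length xs \<Longrightarrow> r \<in> R \<Longrightarrow>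
    lin_ext fscale (\<lambda>q. f (ps @ q # qs)) r = 0"
  shows "mlin_ext f (map (\<lambda>x. quot_map R (gen x)) xs) = f xs"
proof -
  \<comment> \<open>The class representatives form a prefix that grows by one entry at a time. Each
    exchange of a basis element for its representative changes the argument only by an element of
    the span of \<open>R\<close>.\<close>
  have "mlin_ext f (map (\<lambda>x. quot_map R (gen x)) ys @ map gen zs) = f (ys @ zs)"
    if "length ys + length zs = length xs" for ys zs
    using that
  proof (induction ys arbitrary: zs rule: rev_induct)
    case Nil
    then show ?case by (simp add: mlin_ext_gen)
  next
    case (snoc y ys)
    have "mlin_ext f (map (\<lambda>x. quot_map R (gen x)) ys @ (quot_map R (gen y) - gen y) # map gen zs) = 0"
      using snoc.prems
      by (intro mlin_ext_rel free.lin_ext_span_eq_0[OF assms quot_map_diff_in_span]) auto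
    then show ?case
      using snoc.IH[of "y # zs"] snoc.prems by (simp add: mlin_ext_diff)
  qed
  from this[of xs "[]"] show ?thesis by simp
qed

lemma multilin_mlin_ext: "multilin fscale C fscale n (mlin_ext f)"
  by (simp add: multilin_def upd_conv_take_nth_drop mlin_ext_add mlin_ext_fscale)

section \<open>Closure properties of multilinear maps\<close>

lemma multilinI:
  assumes "\<And>us vs a b. length us + length vs + 1 = n \<Longrightarrow> f (us @ (a + b) # vs) = f (us @ a # vs) + f (us @ b # vs)"
    and "\<And>us vs a c. length us + length vs + 1 = n \<Longrightarrow> f (us @ s c a # vs) = s' c (f (us @ a # vs))"
  shows "multilin s UNIV s' n f"
  by (simp add: multilin_def upd_conv_take_nth_drop assms)

lemma multilin_update_add:
  "multilin s C s' n f \<Longrightarrow> length vs = n \<Longrightarrow> set vs \<subseteq> C \<Longrightarrow> i < n \<Longrightarrow> u \<in> C \<Longrightarrow> v \<in> C \<Longrightarrow>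
    f (vs[i := u + v]) = f (vs[i := u]) + f (vs[i := v])"
  and multilin_update_scale:
  "multilin s C s' n f \<Longrightarrow> length vs = n \<Longrightarrow> set vs \<subseteq> C \<Longrightarrow> i < n \<Longrightarrow> u \<in> C \<Longrightarrow>
    f (vs[i := s c u]) = s' c (f (vs[i := u]))"
  by (simp_all add: multilin_def)

lemma multilin_append_add:
  assumes "multilin s UNIV s' n f" "length us + length vs + 1 = n"
  shows "f (us @ (a + b) # vs) = f (us @ a # vs) + f (us @ b # vs)"
  using multilin_update_add[OF assms(1), of "us @ a # vs" "length us" a b] assms(2) by simp

lemma multilin_append_scale:
  assumes "multilin s UNIV s' n f" "length us + length vs + 1 = n"
  shows "f (us @ s c a # vs) = s' c (f (us @ a # vs))"
  using multilin_update_scale[OF assms(1), of "us @ a # vs" "length us" a c] assms(2) by simp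

lemma multilin_append_left:
  assumes "multilin s UNIV s' (m + n) f" "length ys = n"
  shows "multilin s UNIV s' m (\<lambda>xs. f (xs @ ys))"
  by (rule multilinI) (simp_all add: multilin_append_add[OF assms(1)] multilin_append_scale[OF assms(1)] assms(2))

lemma multilin_append_right:
  assumes "multilin s UNIV s' (m + n) f" "length xs = m"
  shows "multilin s UNIV s' n (\<lambda>ys. f (xs @ ys))"
proof (rule multilinI)
  fix us vs :: "'b list" and a b c
  assume n: "length us + length vs + 1 = n"
  show "f (xs @ us @ (a + b) # vs) = f (xs @ us @ a # vs) + f (xs @ us @ b # vs)"
    using multilin_append_add[OF assms(1), of "xs @ us" vs a b] n assms(2) by simp
  show "f (xs @ us @ s c a # vs) = s' c (f (xs @ us @ a # vs))"
    using multilin_append_scale[OF assms(1), of "xs @ us" vs c a] n assms(2) by simp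
qed

lemma multilin_linear:
  assumes "Vector_Spaces.linear s' s'' L" "multilin s C s' n f"
  shows "multilin s C s'' n (\<lambda>vs. L (f vs))"
proof -
  interpret Vector_Spaces.linear s' s'' L by fact
  show ?thesis using assms(2) by (simp add: multilin_def add scale)
qed

lemma (in vector_space) multilin_lin_ext:
  assumes "\<And>b. b \<in> Poly_Mapping.keys u \<Longrightarrow> multilin s C scale n (\<lambda>vs. f vs b)"
  shows "multilin s C scale n (\<lambda>vs. lin_ext scale (f vs) u)"
  unfolding multilin_def lin_ext_add_fun[symmetric] lin_ext_scale_fun[symmetric]
proof (intro allI impI conjI ballI)
  fix i vs a b assume *: "i < n" "length vs = n" "set vs \<subseteq> C" "a \<in> C" "b \<in> C"
  show "lin_ext scale (f (vs[i := a + b])) u =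
      lin_ext scale (\<lambda>q. f (vs[i := a]) q + f (vs[i := b]) q) u"
    by (rule lin_ext_cong) (use assms * in \<open>simp add: multilin_def\<close>)
next
  fix i vs a c assume *: "i < n" "length vs = n" "set vs \<subseteq> C" "a \<in> C"
  show "lin_ext scale (f (vs[i := s c a])) u = lin_ext scale (\<lambda>q. scale c (f (vs[i := a]) q)) u"
    by (rule lin_ext_cong) (use assms * in \<open>simp add: multilin_def\<close>)
qed

lemma map2_update_left:
  "i < length zs \<Longrightarrow> map2 f (vs[i := u]) zs = (map2 f vs zs)[i := f u (zs ! i)]"
proof -
  assume "i < length zs"
  then have "zip (vs[i := u]) zs = (zip vs zs)[i := (u, zs ! i)]"
    using update_zip[of vs zs i "(u, zs ! i)"] by simp
  then show ?thesis by (simp add: map_update)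
qed

lemma multilin_map2_left:
  assumes F: "multilin s2 UNIV s3 n F" and A: "\<And>z. Vector_Spaces.linear s1 s2 (\<lambda>h. A h z)"
    and zs: "length zs = n"
  shows "multilin s1 UNIV s3 n (\<lambda>hs. F (map2 A hs zs))"
proof -
  have "A (u + v) z = A u z + A v z" "A (s1 c u) z = s2 c (A u z)" for u v c z
    using A[of z] by (simp_all add: Vector_Spaces.linear_iff)
  then show ?thesis
    using F zs by (simp add: multilin_def map2_update_left)
qed

lemma map2_swap: "map2 f xs ys = map2 (\<lambda>y x. f x y) ys xs"
  by (subst zip_commute) (simp add: case_prod_beta comp_def)

lemma multilin_map2_right:
  assumes "multilin s2 UNIV s3 n F" "\<And>z. Vector_Spaces.linear s1 s2 (A z)" "length zs = n"
  shows "multilin s1 UNIV s3 n (\<lambda>hs. F (map2 A zs hs))"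
  unfolding map2_swap[of A] using assms by (rule multilin_map2_left)

lemma (in vector_space) lin_ext_pure_multilin:
  "multilin s UNIV scale (length xs) f \<Longrightarrow> lin_ext scale f (pure s xs) = f xs"
  by (rule lin_ext_pure) (simp_all add: multilin_append_add multilin_append_scale)

lemma (in vector_space) lin_ext_tconc:
  assumes "multilin s UNIV scale (m + n) f" "u \<in> tpow s m" "v \<in> tpow s n"
  shows "lin_ext scale f (tconc s u v) = lin_ext scale (\<lambda>xs. lin_ext scale (\<lambda>ys. f (xs @ ys)) v) u"
  unfolding tconc_def lin_ext_comp
  by (intro lin_ext_cong lin_ext_pure_multilin)
    (simp add: keys_tpow[OF assms(2)] keys_tpow[OF assms(3)] assms(1))

lemma (in vector_space) lin_ext_tconc_pure_right:
  assumes f: "multilin s UNIV scale (m + length ys) f" and u: "u \<in> tpow s m"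
  shows "lin_ext scale f (tconc s u (pure s ys)) = lin_ext scale (\<lambda>xs. f (xs @ ys)) u"
  unfolding lin_ext_tconc[OF f u pure_in_tpow[OF refl]]
  by (intro lin_ext_cong lin_ext_pure_multilin multilin_append_right[OF f])
    (simp add: keys_tpow[OF u])

lemma (in vector_space) lin_ext_tconc_pure_left:
  assumes f: "multilin s UNIV scale (length xs + n) f" and v: "v \<in> tpow s n"
  shows "lin_ext scale f (tconc s (pure s xs) v) = lin_ext scale (\<lambda>ys. f (xs @ ys)) v"
  unfolding lin_ext_tconc[OF f pure_in_tpow[OF refl] v]
  by (intro lin_ext_pure_multilin multilin_lin_ext multilin_append_left[OF f])
    (simp add: keys_tpow[OF v])

text \<open>Position \<open>j\<close> of \<open>permute_list \<sigma> vs\<close> holds entry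
  \<open>\<sigma> j\<close> of \<open>vs\<close>, so entry \<open>i\<close> is found at position
  \<open>inv \<sigma> i\<close>.\<close>

lemma permute_list_update:
  assumes "\<sigma> permutes {..<length vs}" "i < length vs"
  shows "permute_list \<sigma> (vs[i := u]) = (permute_list \<sigma> vs)[inv \<sigma> i := u]"
proof (rule nth_equalityI)
  fix j assume "j < length (permute_list \<sigma> (vs[i := u]))"
  then have j: "j < length vs" by simp
  have "\<sigma> j = i \<longleftrightarrow> j = inv \<sigma> i" using permutes_inv_eq[OF assms(1)] by metis
  moreover have "\<sigma> j < length vs" using permutes_in_image[OF assms(1), of j] j by simp
  ultimately show "permute_list \<sigma> (vs[i := u]) ! j = (permute_list \<sigma> vs)[inv \<sigma> i := u] ! j"
    using assms j by (cases "j = inv \<sigma> i") (simp_all add: permute_list_nth)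
qed simp

lemma multilin_permute_list:
  assumes f: "multilin s UNIV s' n f" and \<sigma>: "\<sigma> permutes {..<n}"
  shows "multilin s UNIV s' n (\<lambda>vs. f (permute_list \<sigma> vs))"
  unfolding multilin_def
proof (intro allI impI conjI ballI)
  fix i and vs :: "'b list" and u v c assume *: "i < n" "length vs = n"
  then have upd: "permute_list \<sigma> (vs[i := w]) = (permute_list \<sigma> vs)[inv \<sigma> i := w]" for w
    using permute_list_update[of \<sigma> vs i w] \<sigma> by simp
  have "inv \<sigma> i < n" using permutes_in_image[OF permutes_inv[OF \<sigma>], of i] * by simp
  then show "f (permute_list \<sigma> (vs[i := u + v])) = f (permute_list \<sigma> (vs[i := u])) + f (permute_list \<sigma> (vs[i := v]))"
    "f (permute_list \<sigma> (vs[i := s c u])) = s' c (f (permute_list \<sigma> (vs[i := u])))"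
    using * by (simp_all add: upd multilin_update_add[OF f] multilin_update_scale[OF f])
qed

text \<open>An argument among the first \<open>l\<close> enters the inner \<open>f\<close> and
  reaches the outer one through its first slot; every other argument enters the outer
  \<open>f\<close> directly.\<close>

lemma multilin_nested:
  assumes f: "\<And>n. multilin s UNIV s n f" and l: "l \<le> n"
  shows "multilin s UNIV s n (\<lambda>vs. f (f (take l vs) # drop l vs))"
proof (rule multilinI)
  have cons_add: "f ((a + b) # ws) = f (a # ws) + f (b # ws)" for a b ws
    using multilin_append_add[OF f, of "[]" ws "Suc (length ws)" a b] by simp
  have cons_scale: "f (s c a # ws) = s c (f (a # ws))" for a c ws
    using multilin_append_scale[OF f, of "[]" ws "Suc (length ws)" c a] by simp
  fix us vs :: "'b list" and a b c assume n: "length us + length vs + 1 = n"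
  show "f (f (take l (us @ (a + b) # vs)) # drop l (us @ (a + b) # vs)) =
      f (f (take l (us @ a # vs)) # drop l (us @ a # vs)) + f (f (take l (us @ b # vs)) # drop l (us @ b # vs))"
  proof (cases "length us < l")
    case True
    \<comment> \<open>Writing the number of entries still to be taken as a successor lets
      \<open>take\<close> and \<open>drop\<close> unfold past the distinguished entry.\<close>
    then obtain k where "l - length us = Suc k" by (metis Suc_diff_Suc)
    then show ?thesis
      using True by (simp add: multilin_append_add[OF f refl] cons_add)
  next
    case False
    then show ?thesis
      using multilin_append_add[OF f, of "f (take l us) # drop l us" vs _ a b] by simp
  qed
  show "f (f (take l (us @ s c a # vs)) # drop l (us @ s c a # vs)) =
      s c (f (f (take l (us @ a # vs)) # drop l (us @ a # vs)))"
  proof (cases "length us < l")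
    case True
    then obtain k where "l - length us = Suc k" by (metis Suc_diff_Suc)
    then show ?thesis
      using True by (simp add: multilin_append_scale[OF f refl] cons_scale)
  next
    case False
    then show ?thesis
      using multilin_append_scale[OF f, of "f (take l us) # drop l us" vs _ c a] by simp
  qed
qed


section \<open>Products of nonempty lists\<close>

lemma prod_nonempty_Cons: "ys \<noteq> [] \<Longrightarrow> prod_nonempty (y # ys) = y * prod_nonempty ys"
  by (cases ys) auto

text \<open>Associativity collapses an initial block to a single factor; in a composition of
  brackets this block comes from the inner bracket.\<close>

lemma prod_nonempty_append:
  "us \<noteq> [] \<Longrightarrow> prod_nonempty (us @ vs) = prod_nonempty (prod_nonempty us # vs)"
proof (induction us)
  case (Cons u us)
  then show ?case
    by (cases "us = []"; cases "vs = []") (auto simp: prod_nonempty_Cons mult.assoc)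
qed simp

lemma prod_nonempty_middle:
  fixes y :: "'y::comm_ring"
  shows "prod_nonempty (us @ y # vs) = prod_nonempty (y # us @ vs)"
proof (induction us)
  case (Cons u us)
  then show ?case
    by (cases "us @ vs = []") (simp_all add: prod_nonempty_Cons mult.left_commute mult.commute)
qed simp

text \<open>Commutativity brings the head of \<open>xs\<close> to the front of \<open>ys\<close>,
  and the tails are compared by induction. This is what later absorbs the permutations of tensor
  factors.\<close>

lemma prod_nonempty_mset:
  fixes ys :: "'y::comm_ring list"
  shows "mset xs = mset ys \<Longrightarrow> prod_nonempty xs = prod_nonempty ys"
proof (induction xs arbitrary: ys)
  case (Cons x xs)
  then have "x \<in> set ys" by (metis list.set_intros(1) mset_eq_setD)
  then obtain us vs where ys: "ys = us @ x # vs" by (meson split_list)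
  with Cons.prems have eq: "mset xs = mset (us @ vs)" by simp
  show ?case
  \<comment> \<open>An empty product is \<open>undefined\<close>, so a head can be split off only
    from a list with nonempty tail.\<close>
  proof (cases "xs = []")
    case True
    then show ?thesis using eq ys by simp
  next
    case False
    then have "us @ vs \<noteq> []" using eq by auto
    then show ?thesis
      using Cons.IH[OF eq] False by (simp add: ys prod_nonempty_middle prod_nonempty_Cons)
  qed
qed simp

lemma prod_nonempty_add:
  fixes a :: "'y::comm_ring"
  shows "prod_nonempty (us @ (a + b) # vs) = prod_nonempty (us @ a # vs) + prod_nonempty (us @ b # vs)"
proof -
  have "prod_nonempty ((a + b) # ws) = prod_nonempty (a # ws) + prod_nonempty (b # ws)" for ws
    by (cases ws) (auto simp: distrib_right)
  then show ?thesis by (simp add: prod_nonempty_middle)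
qed

lemma map2_permute_list:
  assumes "\<sigma> permutes {..<length xs}" "length ys = length xs"
  shows "map2 f (permute_list \<sigma> ys) (permute_list \<sigma> xs) = permute_list \<sigma> (map2 f ys xs)"
proof -
  have "permute_list \<sigma> (zip ys xs) = zip (permute_list \<sigma> ys) (permute_list \<sigma> xs)"
    by (rule permute_list_zip[OF assms(1)]) (simp_all add: assms(2))
  then show ?thesis using assms by (simp add: permute_list_map)
qed

lemma map2_nth_split:
  assumes "length gs = n" "\<And>i. i < n \<Longrightarrow> \<exists>y x. gs ! i = f y x \<and> x \<in> D i"
  obtains ys xs where "length ys = n" "length xs = n" "gs = map2 f ys xs" "\<And>i. i < n \<Longrightarrow> xs ! i \<in> D i"
proof -
  from assms(2) obtain Y X where *: "\<And>i. i < n \<Longrightarrow> gs ! i = f (Y i) (X i) \<and> X i \<in> D i"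
    by metis
  show ?thesis
    by (rule that[of "map Y [0..<n]" "map X [0..<n]"]) (auto intro!: nth_equalityI simp: assms(1) *)
qed


section \<open>Projections onto graded components\<close>

lemma (in vector_space) span_Union_subspaces:
  assumes G: "\<And>m. subspace (G m)" and z: "z \<in> span (\<Union>m\<in>J. G m)"
  shows "\<exists>I v. finite I \<and> I \<subseteq> J \<and> (\<forall>m. v m \<in> G m) \<and> z = (\<Sum>m\<in>I. v m)"
proof -
  \<comment> \<open>The family is required to vanish outside \<open>I\<close>, so that a further
    term of degree \<open>m\<close> can be added at \<open>m\<close> whether or not \<open>m\<close>
    already lies in \<open>I\<close>.\<close>
  have "\<exists>I v. finite I \<and> I \<subseteq> J \<and> (\<forall>m. v m \<in> G m) \<and> (\<forall>m. m \<notin> I \<longrightarrow> v m = 0) \<and> z = (\<Sum>m\<in>I. v m)"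
    using z
  proof (induction rule: span_induct_alt)
    case base
    show ?case using subspace_0[OF G] by (intro exI[of _ "{}"] exI[of _ "\<lambda>_. 0"]) simp
  next
    case (step c x y)
    then obtain m I v where *: "m \<in> J" "x \<in> G m" "finite I" "I \<subseteq> J" "\<And>m. v m \<in> G m"
      "\<And>m. m \<notin> I \<Longrightarrow> v m = 0" "y = (\<Sum>m\<in>I. v m)" by blast
    let ?v = "v(m := scale c x + v m)"
    have "(\<Sum>j\<in>insert m I. ?v j) = ?v m + (\<Sum>j\<in>I - {m}. ?v j)"
      using * by (simp add: sum.insert_remove)
    also have "(\<Sum>j\<in>I - {m}. ?v j) = (\<Sum>j\<in>I - {m}. v j)" by (rule sum.cong) auto
    also have "?v m + (\<Sum>j\<in>I - {m}. v j) = scale c x + y"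
      using * by (cases "m \<in> I") (simp_all add: sum.remove[of I m v] add.assoc)
    finally show ?case
      using * subspace_add[OF G] subspace_scale[OF G]
      by (intro exI[of _ "insert m I"] exI[of _ ?v]) simp
  qed
  then show ?thesis by blast
qed

text \<open>The projection onto degree \<open>n\<close> along the sum of the other degrees.
  Characterising the component by its complement means that its properties follow from uniqueness,
  without handling full decompositions.\<close>

definition (in vector_space) gproj :: "(int \<Rightarrow> 'b set) \<Rightarrow> int \<Rightarrow> 'b \<Rightarrow> 'b" where
  "gproj G n x = (THE a. a \<in> G n \<and> x - a \<in> span (\<Union>m\<in>-{n}. G m))"

context vector_space
begin

text \<open>For existence, induct over the span: a term of degree \<open>n\<close> is added to the
  component and any other term is absorbed by the complement. Uniqueness is directness of the
  sum.\<close>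

lemma gproj_ex1:
  assumes G: "graded_space scale UNIV G"
  shows "\<exists>!a. a \<in> G n \<and> x - a \<in> span (\<Union>m\<in>-{n}. G m)"
proof -
  have sub: "subspace (G m)" for m using G by (simp add: graded_space_def)
  have direct: "\<forall>m\<in>I. v m = 0" if "finite I" "\<forall>m\<in>I. v m \<in> G m" "(\<Sum>m\<in>I. v m) = 0" for I v
    using G[unfolded graded_space_def, THEN conjunct2, THEN conjunct2, rule_format, OF that(1) _ that(3)] that(2)
    by blast
  have "x \<in> span (\<Union>m. G m)" using G by (simp add: graded_space_def)
  then have ex: "\<exists>a. a \<in> G n \<and> x - a \<in> span (\<Union>m\<in>-{n}. G m)"
  proof (induction rule: span_induct_alt)
    case base
    show ?case using subspace_0[OF sub] by (auto intro!: exI[of _ 0] span_zero)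
  next
    case (step c x y)
    then obtain m a where *: "x \<in> G m" "a \<in> G n" "y - a \<in> span (\<Union>m\<in>-{n}. G m)" by blast
    show ?case
    proof (cases "m = n")
      case True
      then show ?thesis
        using * subspace_add[OF sub] subspace_scale[OF sub]
        by (intro exI[of _ "scale c x + a"]) (simp add: add_diff_add)
    next
      case False
      then have "scale c x \<in> span (\<Union>m\<in>-{n}. G m)"
        using * by (intro span_scale span_base) auto
      then show ?thesis
        using * span_add by (intro exI[of _ a]) (simp add: add_diff_eq[symmetric])
    qed
  qed
  have uniq: "a = b"
    if "a \<in> G n" "x - a \<in> span (\<Union>m\<in>-{n}. G m)" "b \<in> G n" "x - b \<in> span (\<Union>m\<in>-{n}. G m)" for a b
  proof -
    have "b - a \<in> span (\<Union>m\<in>-{n}. G m)"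
      using span_diff[OF that(2) that(4)] by simp
    from span_Union_subspaces[OF sub this] obtain I v where *: "finite I" "I \<subseteq> -{n}" "\<forall>m. v m \<in> G m" "b - a = (\<Sum>m\<in>I. v m)"
      by blast
    \<comment> \<open>Placing \<open>a - b\<close> in degree \<open>n\<close> against the expansion
      of \<open>b - a\<close> in the other degrees gives a vanishing sum of homogeneous elements,
      whence \<open>a - b = 0\<close>.\<close>
    let ?v = "v(n := a - b)"
    have "(\<Sum>m\<in>I. ?v m) = (\<Sum>m\<in>I. v m)" using * by (intro sum.cong) auto
    moreover have "n \<notin> I" using *(2) by blast
    ultimately have "(\<Sum>m\<in>insert n I. ?v m) = (a - b) + (b - a)"
      unfolding *(4) by (subst sum.insert[OF *(1)]) simp_all
    then have "(\<Sum>m\<in>insert n I. ?v m) = 0" by simp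
    moreover have "\<forall>m\<in>insert n I. ?v m \<in> G m"
      using *(3) subspace_diff[OF sub that(1) that(3)] by simp
    moreover have "finite (insert n I)" using *(1) by simp
    ultimately have "\<forall>m\<in>insert n I. ?v m = 0"
      by (intro direct)
    then show "a = b" by simp
  qed
  show ?thesis using ex uniq by blast
qed

lemma gproj_eqI:
  assumes "graded_space scale UNIV G" "a \<in> G n" "x - a \<in> span (\<Union>m\<in>-{n}. G m)"
  shows "gproj G n x = a"
  unfolding gproj_def using assms gproj_ex1[OF assms(1), of n x] by (intro the1_equality) auto

lemma gproj:
  assumes "graded_space scale UNIV G"
  shows "gproj G n x \<in> G n" "x - gproj G n x \<in> span (\<Union>m\<in>-{n}. G m)"
  using theI'[OF gproj_ex1[OF assms, of n x]] by (auto simp: gproj_def)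

lemma gproj_same: "graded_space scale UNIV G \<Longrightarrow> x \<in> G n \<Longrightarrow> gproj G n x = x"
  by (rule gproj_eqI) (auto intro: span_zero)

lemma gproj_other:
  assumes "graded_space scale UNIV G" "x \<in> G m" "m \<noteq> n"
  shows "gproj G n x = 0"
  using assms by (intro gproj_eqI) (auto intro!: span_base subspace_0 simp: graded_space_def)

text \<open>\<open>T\<close> preserves every degree, so it carries the decomposition of
  \<open>x\<close> to one of \<open>T x\<close>, and these are unique. For \<open>T\<close> the
  action of an element of \<open>H\<close>, this makes the projection
  \<open>H\<close>-linear.\<close>

lemma gproj_commute:
  assumes G: "graded_space scale UNIV G" and T: "Vector_Spaces.linear scale scale T"
    and TG: "\<And>m x. x \<in> G m \<Longrightarrow> T x \<in> G m"
  shows "gproj G n (T x) = T (gproj G n x)"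
proof (rule gproj_eqI[OF G])
  interpret T: Vector_Spaces.linear scale scale T by fact
  show "T (gproj G n x) \<in> G n" by (intro TG gproj(1)[OF G])
  let ?N = "span (\<Union>m\<in>-{n}. G m)"
  have "T w \<in> ?N" if "w \<in> ?N" for w
    using that
  proof (induction rule: span_induct_alt)
    case (step c x y)
    then have "T x \<in> ?N" by (auto intro!: span_base TG)
    with step show ?case by (simp add: T.add T.scale span_add span_scale)
  qed (simp add: T.zero span_zero)
  from this[OF gproj(2)[OF G]] show "T x - T (gproj G n x) \<in> ?N" by (simp add: T.diff)
qed

lemma linear_gproj:
  assumes G: "graded_space scale UNIV G"
  shows "Vector_Spaces.linear scale scale (gproj G n)"
proof -
  have sub: "subspace (G n)" using G by (simp add: graded_space_def)
  have "gproj G n (x + y) = gproj G n x + gproj G n y" for x y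
    using gproj[OF G, where n = n and x = x] gproj[OF G, where n = n and x = y]
    by (intro gproj_eqI[OF G] subspace_add[OF sub]) (simp_all add: add_diff_add span_add)
  moreover have "gproj G n (scale c x) = scale c (gproj G n x)" for c x
    using gproj[OF G, where n = n and x = x]
    by (intro gproj_eqI[OF G] subspace_scale[OF sub])
      (simp_all add: scale_right_diff_distrib[symmetric] span_scale)
  ultimately show ?thesis by unfold_locales
qed

end


section \<open>The bracket on the annihilation algebra\<close>

locale annihilation =
  H: cocommutative_hopf_algebra sH cop eps antipode +
  Y: differential_bimodule_algebra sH cop sY lact ract +
  L: L_infty_pseudoalgebra sH cop eps sL act G \<beta>
  for sH :: "'k::field \<Rightarrow> 'h::ring_1 \<Rightarrow> 'h"
    and cop :: "'h \<Rightarrow> ('h list \<Rightarrow>\<^sub>0 'k)" and eps :: "'h \<Rightarrow> 'k" and antipode :: "'h \<Rightarrow> 'h"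
    and sY :: "'k \<Rightarrow> 'y::comm_ring \<Rightarrow> 'y"
    and lact :: "'h \<Rightarrow> 'y \<Rightarrow> 'y" and ract :: "'y \<Rightarrow> 'h \<Rightarrow> 'y"
    and sL :: "'k \<Rightarrow> 'l::ab_group_add \<Rightarrow> 'l" and act :: "'h \<Rightarrow> 'l \<Rightarrow> 'l"
    and G :: "int \<Rightarrow> 'l set"
    and \<beta> :: "'l list \<Rightarrow> (('h list \<Rightarrow>\<^sub>0 'k) \<times> 'l \<Rightarrow>\<^sub>0 'k)"
begin

abbreviation "tens \<equiv> annih_tens sY ract sL act"
abbreviation "AY \<equiv> annih_space sY ract sL act"
abbreviation "ptn \<equiv> ptens sH cop eps sL act"
abbreviation "psp \<equiv> pspace sH cop eps sL act"
abbreviation "pmp \<equiv> pmap sH cop eps sL act"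
abbreviation "tactH \<equiv> tact sH cop eps"
abbreviation "copn \<equiv> cop_iter sH cop eps"

text \<open>\<open>ract_mult\<close> names two laws, associativity of the right action and its
  Leibniz rule; they are told apart here.\<close>

lemmas ract_comp = right_module.ract_mult[OF Y.right_module_axioms]
lemmas ract_prod = differential_bimodule_algebra.ract_mult[OF Y.differential_bimodule_algebra_axioms]

lemma linear_tens_left: "Vector_Spaces.linear sY fscale (\<lambda>y. tens y x)"
  by unfold_locales (simp_all add: btens_add_left btens_scale_left)

lemma linear_tens_right: "Vector_Spaces.linear sL fscale (tens y)"
  by unfold_locales (simp_all add: btens_add_right btens_scale_right)

lemma linear_ract: "Vector_Spaces.linear sY sY (\<lambda>y. ract y h)"
  by unfold_locales (simp_all add: Y.ract_add_left Y.ract_scale_left)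

lemma linear_ract_right: "Vector_Spaces.linear sH sY (ract y)"
  by unfold_locales (simp_all add: Y.ract_add_right Y.ract_scale_right)

lemma linear_lact: "Vector_Spaces.linear sY sY (lact h)"
  by unfold_locales (simp_all add: Y.act_add_right Y.act_scale_right)

lemma linear_lact_left: "Vector_Spaces.linear sH sY (\<lambda>h. lact h y)"
  by unfold_locales (simp_all add: Y.act_add_left Y.act_scale_left)

lemma linear_times: "Vector_Spaces.linear sY sY ((*) y)"
  by unfold_locales
    (simp_all add: distrib_left Y.scale_mult mult.commute[of y])

lemma multilin_prod_nonempty: "multilin sY UNIV sY n prod_nonempty"
proof (rule multilinI)
  fix us vs a c
  have "prod_nonempty (sY c a # ws) = sY c (prod_nonempty (a # ws))" for ws
    by (cases ws) (simp_all add: Y.scale_mult)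
  then show "prod_nonempty (us @ sY c a # vs) = sY c (prod_nonempty (us @ a # vs))"
    by (simp add: prod_nonempty_middle)
qed (simp add: prod_nonempty_add)

text \<open>
  The evaluations \<open>(f\<^sub>1 \<otimes> \<dots> \<otimes> f\<^sub>n) \<mapsto> (y\<^sub>1 f\<^sub>1) \<cdots> (y\<^sub>n f\<^sub>n)\<close> on \<open>H\<^bsup>\<otimes>n\<^esup>\<close> and
  \<open>u \<otimes>\<^sub>H x \<mapsto> yev ys u \<otimes>\<^sub>H x\<close> on \<open>H\<^bsup>\<otimes>n\<^esup> \<otimes>\<^sub>H L\<close>.
\<close>

definition yev :: "'y list \<Rightarrow> ('h list \<Rightarrow>\<^sub>0 'k) \<Rightarrow> 'y" where
  "yev ys m = lin_ext sY (\<lambda>fs. prod_nonempty (map2 ract ys fs)) m"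

definition pev :: "'y list \<Rightarrow> (('h list \<Rightarrow>\<^sub>0 'k) \<times> 'l \<Rightarrow>\<^sub>0 'k) \<Rightarrow> ('y \<times> 'l \<Rightarrow>\<^sub>0 'k)" where
  "pev ys v = lin_ext fscale (\<lambda>(m, x). tens (yev ys m) x) v"

lemma linear_yev: "Vector_Spaces.linear fscale sY (yev ys)"
  unfolding yev_def[abs_def] by (rule Y.linear_lin_ext)

lemma linear_pev: "Vector_Spaces.linear fscale fscale (pev ys)"
  unfolding pev_def[abs_def] by (rule free.linear_lin_ext)

lemma multilin_prod_ract:
  "length ys = n \<Longrightarrow> multilin sH UNIV sY n (\<lambda>fs. prod_nonempty (map2 ract ys fs))"
  by (rule multilin_map2_right[OF multilin_prod_nonempty linear_ract_right])

lemma yev_pure: "length fs = length ys \<Longrightarrow> yev ys (pure sH fs) = prod_nonempty (map2 ract ys fs)"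
  unfolding yev_def by (rule Y.lin_ext_pure_multilin) (simp add: multilin_prod_ract)

lemma multilin_yev:
  assumes "m \<in> tpow sH n"
  shows "multilin sY UNIV sY n (\<lambda>ys. yev ys m)"
  unfolding yev_def
  by (intro Y.multilin_lin_ext multilin_map2_left[OF multilin_prod_nonempty linear_ract])
    (rule keys_tpow[OF assms])

lemma multilin_pev:
  assumes "v \<in> psp n D"
  shows "multilin sY UNIV fscale n (\<lambda>ys. pev ys v)"
  unfolding pev_def
proof (intro free.multilin_lin_ext, clarify)
  fix m x assume "(m, x) \<in> Poly_Mapping.keys v"
  then have "m \<in> tpow sH n" using assms by (rule keys_pspace[rotated])
  then show "multilin sY UNIV fscale n (\<lambda>ys. tens (yev ys m) x)"
    by (intro multilin_linear[OF linear_tens_left] multilin_yev)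
qed

lemma map2_ract_mult: "map2 ract ys (map2 (*) xs gs) = map2 ract (map2 ract ys xs) gs"
  by (rule nth_equalityI) (simp_all add: ract_comp)

text \<open>Associativity \<open>y(xg) = (yx)g\<close> in every slot moves the left factor of a
  product in the tensor power of \<open>H\<close> into the list of the \<open>y\<close>.\<close>

lemma yev_tmul:
  assumes "u \<in> tpow sH (length ys)" "m \<in> tpow sH (length ys)"
  shows "yev ys (tmul sH u m) = lin_ext sY (\<lambda>hs. yev (map2 ract ys hs) m) u"
  unfolding tmul_def linear_lin_ext_comp[OF linear_yev] yev_def[of "map2 _ _ _"]
  by (intro lin_ext_cong)
    (simp add: yev_pure keys_tpow[OF assms(1)] keys_tpow[OF assms(2)] map2_ract_mult)

lemma yev_tmul_pure:
  assumes "length hs = length ys" "m \<in> tpow sH (length ys)"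
  shows "yev ys (tmul sH (pure sH hs) m) = yev (map2 ract ys hs) m"
  unfolding yev_tmul[OF pure_in_tpow[OF assms(1)] assms(2)]
  by (intro Y.lin_ext_pure_multilin multilin_map2_right[OF multilin_yev linear_ract_right])
    (simp_all add: assms)

text \<open>\<open>A\<close> stands for either of the two actions of \<open>H\<close> on \<open>Y\<close>.\<close>

lemma leibniz_iter:
  assumes lin: "\<And>y. Vector_Spaces.linear sH sY (\<lambda>h. A h y)"
    and leib: "\<And>h y z. A h (y * z) = lin_ext sY (\<lambda>p. A (p ! 0) y * A (p ! 1) z) (cop h)"
    and "zs \<noteq> []"
  shows "A h (prod_nonempty zs) = lin_ext sY (\<lambda>hs. prod_nonempty (map2 A hs zs)) (copn (length zs) h)"
  using assms(3)
proof (induction zs arbitrary: h)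
  case (Cons z zs)
  have step: "lin_ext sY (\<lambda>hs. prod_nonempty (map2 A hs (z # zs)))
        (tconc sH (pure sH [a]) (copn (length zs) b)) =
      lin_ext sY (\<lambda>hs. prod_nonempty (A a z # map2 A hs zs)) (copn (length zs) b)" for a b
    by (subst Y.lin_ext_tconc_pure_left[OF _ cop_iter_in_tpow])
      (simp_all add: multilin_map2_left[OF multilin_prod_nonempty lin])
  show ?case
  proof (cases "zs = []")
    \<comment> \<open>The induction really starts with one factor. There the iterated coproduct ends
      in the counit, and the counit axiom gives back the action of \<open>h\<close>.\<close>
    case True
    \<comment> \<open>A relation involves a list with at least one entry, so there are none in
      tensor degree zero.\<close>
    have "pure sH [] = gen []"
    proof -
      have "tp_rel sH 0 = {}" by (auto simp: tp_rel_def)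
      then have "quot_map (tp_rel sH 0) (gen []) - gen [] \<in> free.span {}"
        using quot_map_diff_in_span[of "tp_rel sH 0" "gen []"] by simp
      then show ?thesis by (simp add: pure_def)
    qed
    then have "lin_ext sY (\<lambda>hs. prod_nonempty (map2 A hs [z])) (copn 1 h) =
        lin_ext sY (\<lambda>p. sY (eps (p ! 1)) (A (p ! 0) z)) (cop h)"
      using step True by (simp add: Y.lin_ext_comp Y.lin_ext_fscale)
    also have "\<dots> = A (lin_ext sH (\<lambda>p. sH (eps (p ! 1)) (p ! 0)) (cop h)) z"
      using lin[of z] by (simp add: linear_lin_ext_comp[OF lin] Vector_Spaces.linear_iff)
    finally show ?thesis
      using True H.counit_right[of h] by simp
  next
    case False
    have "A h (prod_nonempty (z # zs)) =
        lin_ext sY (\<lambda>p. A (p ! 0) z * A (p ! 1) (prod_nonempty zs)) (cop h)"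
      using False by (simp add: prod_nonempty_Cons leib)
    also have "\<dots> = lin_ext sY (\<lambda>p. lin_ext sY (\<lambda>hs. A (p ! 0) z * prod_nonempty (map2 A hs zs))
        (copn (length zs) (p ! 1))) (cop h)"
      by (simp add: Cons.IH[OF False] linear_lin_ext_comp[OF linear_times])
    also have "\<dots> = lin_ext sY (\<lambda>p. lin_ext sY (\<lambda>hs. prod_nonempty (A (p ! 0) z # map2 A hs zs))
        (copn (length zs) (p ! 1))) (cop h)"
    proof (intro lin_ext_cong)
      fix p hs assume "hs \<in> Poly_Mapping.keys (copn (length zs) (p ! 1))"
      then have "length hs = length zs" by (rule keys_tpow[OF cop_iter_in_tpow])
      then show "A (p ! 0) z * prod_nonempty (map2 A hs zs) = prod_nonempty (A (p ! 0) z # map2 A hs zs)"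
        using False by (subst prod_nonempty_Cons) auto
    qed
    finally show ?thesis
      by (simp add: Y.lin_ext_comp step[simplified])
  qed
qed simp

lemma ract_prod_nonempty:
  "zs \<noteq> [] \<Longrightarrow> ract (prod_nonempty zs) h = yev zs (copn (length zs) h)"
  unfolding yev_def map2_swap[of ract]
  by (rule leibniz_iter[OF linear_ract_right ract_prod])

lemma lact_prod_nonempty:
  "zs \<noteq> [] \<Longrightarrow> lact h (prod_nonempty zs) = lin_ext sY (\<lambda>hs. prod_nonempty (map2 lact hs zs)) (copn (length zs) h)"
  by (rule leibniz_iter[OF linear_lact_left Y.lact_mult])

text \<open>The right \<open>H\<close>-linearity of the evaluation. The action multiplies by the
  iterated coproduct, and evaluating that on the factors \<open>y f\<close> is, by the Leibniz rule,
  the action of \<open>h\<close> on their product.\<close>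

lemma yev_tact:
  assumes "ys \<noteq> []" "u \<in> tpow sH (length ys)"
  shows "yev ys (tactH (length ys) u h) = ract (yev ys u) h"
proof -
  have "yev ys (tactH (length ys) u h) = lin_ext sY (\<lambda>fs. yev (map2 ract ys fs) (copn (length ys) h)) u"
    unfolding tact_def by (rule yev_tmul[OF assms(2) cop_iter_in_tpow])
  also have "\<dots> = lin_ext sY (\<lambda>fs. ract (prod_nonempty (map2 ract ys fs)) h) u"
  proof (rule lin_ext_cong)
    fix fs assume "fs \<in> Poly_Mapping.keys u"
    then have "length fs = length ys" by (rule keys_tpow[OF assms(2)])
    then show "yev (map2 ract ys fs) (copn (length ys) h) = ract (prod_nonempty (map2 ract ys fs)) h"
      using assms(1) by (subst ract_prod_nonempty) auto
  qed
  finally show ?thesis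
    by (simp add: yev_def linear_lin_ext_comp[OF linear_ract])
qed

text \<open>By \<open>yev_tact\<close> the map sending \<open>(m, x)\<close> to
  \<open>tens (yev ys m) x\<close> is balanced over \<open>H\<close>, so \<open>pev\<close> does not
  depend on representatives.\<close>

lemma pev_ptens:
  assumes "ys \<noteq> []"
  shows "pev ys (ptn (length ys) m x) = tens (yev ys m) x"
proof -
  have "lin_ext fscale (\<lambda>(m, x). tens (yev ys m) x) (ptn (length ys) m x) =
      (\<lambda>(m, x). tens (yev ys m) x) (m, x)"
    using linear_yev[of ys] linear_tens_left linear_tens_right
    by (intro free.lin_ext_btens)
      (simp_all add: Vector_Spaces.linear_iff yev_tact[OF assms] btens_balanced)
  then show ?thesis by (simp add: pev_def)
qed

lemma pev_pmap:
  assumes "ys \<noteq> []"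
  shows "pev ys (pmp (length ys) f v) = lin_ext fscale (\<lambda>(m, x). tens (yev ys (f m)) x) v"
  unfolding bmap_def linear_lin_ext_comp[OF linear_pev]
  by (intro lin_ext_cong) (simp add: pev_ptens[OF assms] split: prod.split)

lemma pev_pmap_tmul:
  assumes "ys \<noteq> []" "length hs = length ys" "v \<in> psp (length ys) D"
  shows "pev ys (pmp (length ys) (tmul sH (pure sH hs)) v) = pev (map2 ract ys hs) v"
  unfolding pev_pmap[OF assms(1)] pev_def[of "map2 ract ys hs"]
proof (intro lin_ext_cong, clarify)
  fix m x assume "(m, x) \<in> Poly_Mapping.keys v"
  then have "m \<in> tpow sH (length ys)" using assms(3) by (rule keys_pspace[rotated])
  then show "tens (yev ys (tmul sH (pure sH hs) m)) x = tens (yev (map2 ract ys hs) m) x"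
    by (simp add: yev_tmul_pure assms(2))
qed

text \<open>\<open>tperm\<close> puts \<open>f\<close> number \<open>j\<close> in position
  \<open>\<sigma> j\<close>, where it meets the \<open>y\<close> with that index. The permuted list
  \<open>permute_list \<sigma> ys\<close> produces the same pairs in a different order, which
  commutativity ignores.\<close>

lemma yev_tperm:
  assumes "\<sigma> permutes {..<length ys}" "m \<in> tpow sH (length ys)"
  shows "yev ys (tperm sH \<sigma> m) = yev (permute_list \<sigma> ys) m"
  unfolding tperm_def linear_lin_ext_comp[OF linear_yev] yev_def[of "permute_list \<sigma> ys"]
proof (intro lin_ext_cong)
  fix fs assume "fs \<in> Poly_Mapping.keys m"
  then have len: "length fs = length ys" by (rule keys_tpow[OF assms(2)])
  let ?gs = "permute_list (inv \<sigma>) fs"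
  have inv: "inv \<sigma> permutes {..<length ys}" using assms(1) by (rule permutes_inv)
  have gs: "permute_list \<sigma> ?gs = fs"
    using permute_list_compose[of \<sigma> fs "inv \<sigma>"] assms(1) len by (simp add: permutes_inv_o)
  have "map2 ract (permute_list \<sigma> ys) (permute_list \<sigma> ?gs) = permute_list \<sigma> (map2 ract ys ?gs)"
    by (rule map2_permute_list) (simp_all add: assms(1) len)
  then have "mset (map2 ract (permute_list \<sigma> ys) fs) = mset (map2 ract ys ?gs)"
    unfolding gs by (simp add: assms(1) len)
  then have "prod_nonempty (map2 ract (permute_list \<sigma> ys) fs) = prod_nonempty (map2 ract ys ?gs)"
    by (rule prod_nonempty_mset)
  then show "yev ys (pure sH ?gs) = prod_nonempty (map2 ract (permute_list \<sigma> ys) fs)"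
    by (simp add: yev_pure len)
qed

lemma pev_pmap_tperm:
  assumes "ys \<noteq> []" "\<sigma> permutes {..<length ys}" "v \<in> psp (length ys) D"
  shows "pev ys (pmp (length ys) (tperm sH \<sigma>) v) = pev (permute_list \<sigma> ys) v"
  unfolding pev_pmap[OF assms(1)] pev_def[of "permute_list \<sigma> ys"]
proof (intro lin_ext_cong, clarify)
  fix m x assume "(m, x) \<in> Poly_Mapping.keys v"
  then have "m \<in> tpow sH (length ys)" using assms(3) by (rule keys_pspace[rotated])
  then show "tens (yev ys (tperm sH \<sigma> m)) x = tens (yev (permute_list \<sigma> ys) m) x"
    by (simp add: yev_tperm[OF assms(2)])
qed

text \<open>Evaluation leaves the factor in \<open>L\<close> untouched; taking for \<open>D\<close>
  a component of \<open>L\<close> shows that it respects degrees.\<close>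

lemma pev_in_bspace:
  assumes "ys \<noteq> []" "v \<in> psp (length ys) D"
  shows "pev ys v \<in> bspace sY UNIV ract sL act D"
proof -
  interpret Vector_Spaces.linear fscale fscale "pev ys" by (rule linear_pev)
  show ?thesis
    using assms(2) unfolding bspace_def[of fscale]
  proof (induction rule: free.span_induct_alt)
    case base
    show ?case by (simp add: zero free.subspace_0[OF subspace_bspace])
  next
    case (step c v w)
    then obtain m x where "v = ptn (length ys) m x" "x \<in> D" by blast
    then have "pev ys v \<in> bspace sY UNIV ract sL act D"
      by (simp add: pev_ptens[OF assms(1)] btens_in_bspace)
    with step show ?case
      by (simp add: add scale free.subspace_add[OF subspace_bspace] free.subspace_scale[OF subspace_bspace])
  qed
qed

lemma pev_in_annih: "pev ys v \<in> AY"
  unfolding pev_def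
  by (intro free.lin_ext_in_subspace[OF subspace_bspace]) (auto intro: btens_in_bspace)

section \<open>Construction of the bracket on tensors over \<open>H\<close>\<close>

lemma beta_add: "\<beta> (us @ (a + b) # vs) = \<beta> (us @ a # vs) + \<beta> (us @ b # vs)"
  and beta_scale: "\<beta> (us @ sL c a # vs) = fscale c (\<beta> (us @ a # vs))"
  and beta_in: "xs \<noteq> [] \<Longrightarrow> \<beta> xs \<in> psp (length xs) UNIV"
  using L.multilinear by (simp_all add: multilinear_family_def)

lemma map2_act_one: "length xs \<le> k \<Longrightarrow> map2 act (replicate k 1) xs = xs"
  by (rule nth_equalityI) (simp_all add: L.act_one)

lemma map2_ract_one: "length ys \<le> k \<Longrightarrow> map2 ract ys (replicate k 1) = ys"
  by (rule nth_equalityI) (simp_all add: Y.ract_one)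

text \<open>Apply \<open>H\<close>-linearity of \<beta> to the tuple with \<open>h\<close> in one
  slot and \<open>1\<close> in the others: acting on \<open>x\<close> becomes a left multiplication,
  which the evaluation transfers to \<open>y\<close>.\<close>

lemma pev_beta_balanced:
  assumes len: "length ys1 = length xs1" "length ys2 = length xs2"
  shows "pev (ys1 @ ract y h # ys2) (\<beta> (xs1 @ x # xs2)) = pev (ys1 @ y # ys2) (\<beta> (xs1 @ act h x # xs2))"
proof -
  let ?hs = "replicate (length xs1) 1 @ h # replicate (length xs2) 1"
  let ?xs = "xs1 @ x # xs2" and ?ys = "ys1 @ y # ys2"
  have "map2 act ?hs ?xs = xs1 @ act h x # xs2"
    by (simp add: map2_act_one)
  then have "\<beta> (xs1 @ act h x # xs2) = pmp (length ?ys) (tmul sH (pure sH ?hs)) (\<beta> ?xs)"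
    using L.H_linear[of ?xs ?hs] len by simp
  moreover have "map2 ract ?ys ?hs = ys1 @ ract y h # ys2"
    using len by (simp add: map2_ract_one)
  moreover have "\<beta> ?xs \<in> psp (length ?ys) UNIV" using beta_in[of ?xs] len by simp
  ultimately show ?thesis
    using pev_pmap_tmul[of ?ys ?hs "\<beta> ?xs" UNIV] len by simp
qed

text \<open>The bracket on basis elements of the free space, before any tensor relation is
  imposed.\<close>

definition raw_bracket :: "('y \<times> 'l) list \<Rightarrow> ('y \<times> 'l \<Rightarrow>\<^sub>0 'k)" where
  "raw_bracket ps = pev (map fst ps) (\<beta> (map snd ps))"

definition bracket :: "('y \<times> 'l \<Rightarrow>\<^sub>0 'k) list \<Rightarrow> ('y \<times> 'l \<Rightarrow>\<^sub>0 'k)" where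
  "bracket = mlin_ext raw_bracket"

lemma multilin_bracket: "multilin fscale C fscale n bracket"
  unfolding bracket_def by (rule multilin_mlin_ext)

lemma bracket_in: "bracket vs \<in> AY"
  unfolding bracket_def raw_bracket_def
  by (intro mlin_ext_in_subspace[OF subspace_bspace] pev_in_annih)

text \<open>Relations in \<open>y\<close> follow from multilinearity of the evaluation, those in
  \<open>x\<close> from multilinearity of \<beta>, and the balancing relation from
  \<open>pev_beta_balanced\<close>.\<close>

lemma raw_bracket_rel:
  assumes "r \<in> bal_rel sY UNIV ract sL act"
  shows "lin_ext fscale (\<lambda>q. raw_bracket (ps @ q # qs)) r = 0"
proof (rule free.lin_ext_bal_rel[where C = UNIV and sM = sY and r = ract and sL = sL and a = act, OF _ _ _ _ _ assms])
  interpret pev: Vector_Spaces.linear fscale fscale "pev ys" for ys by (rule linear_pev)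
  have psp: "\<beta> (map snd ps @ x # map snd qs) \<in> psp (length ps + length qs + 1) UNIV" for x
    using beta_in[of "map snd ps @ x # map snd qs"] by simp
  fix m m' x x' c h
  show "raw_bracket (ps @ (m + m', x) # qs) = raw_bracket (ps @ (m, x) # qs) + raw_bracket (ps @ (m', x) # qs)"
    "raw_bracket (ps @ (sY c m, x) # qs) = fscale c (raw_bracket (ps @ (m, x) # qs))"
    by (simp_all add: raw_bracket_def multilin_append_add[OF multilin_pev[OF psp]]
        multilin_append_scale[OF multilin_pev[OF psp]])
  show "raw_bracket (ps @ (m, x + x') # qs) = raw_bracket (ps @ (m, x) # qs) + raw_bracket (ps @ (m, x') # qs)"
    "raw_bracket (ps @ (m, sL c x) # qs) = fscale c (raw_bracket (ps @ (m, x) # qs))"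
    by (simp_all add: raw_bracket_def beta_add beta_scale pev.add pev.scale)
  show "raw_bracket (ps @ (ract m h, x) # qs) = raw_bracket (ps @ (m, act h x) # qs)"
    by (simp add: raw_bracket_def pev_beta_balanced)
qed

text \<open>Each tensor is the chosen representative of a basis element, and
  \<open>raw_bracket\<close> kills the relations in every slot, so its value can be read off on
  basis elements.\<close>

lemma bracket_tens:
  assumes "length ys = length xs"
  shows "bracket (map2 tens ys xs) = pev ys (\<beta> xs)"
proof -
  have eq: "map2 tens ys xs = map (\<lambda>p. quot_map (bal_rel sY UNIV ract sL act) (gen p)) (zip ys xs)"
    by (simp add: btens_def case_prod_beta)
  show ?thesis
    unfolding bracket_def eq
    by (subst mlin_ext_quot_map_gen[OF raw_bracket_rel]) (simp_all add: raw_bracket_def assms)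
qed

section \<open>The defining formula and uniqueness\<close>

text \<open>The formula in \<open>annih_bracket\<close> speaks only about expansions of \<beta> into
  pure tensors; uniqueness requires that such an expansion exists.\<close>

lemma pspace_sum_pure:
  assumes "v \<in> psp n UNIV"
  obtains ts where "\<forall>(fs, e)\<in>set ts. length fs = n" "v = (\<Sum>(fs, e)\<leftarrow>ts. ptn n (pure sH fs) e)"
proof -
  let ?P = "\<lambda>v. \<exists>ts. (\<forall>(fs, e)\<in>set ts. length fs = n) \<and> v = (\<Sum>(fs, e)\<leftarrow>ts. ptn n (pure sH fs) e)"
  have P0: "?P 0" by (intro exI[of _ "[]"]) simp
  have Padd: "?P (v + w)" if v: "?P v" and w: "?P w" for v w
  proof -
    from v obtain ts where "\<forall>(fs, e)\<in>set ts. length fs = n" "v = (\<Sum>(fs, e)\<leftarrow>ts. ptn n (pure sH fs) e)" by blast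
    moreover from w obtain us where "\<forall>(fs, e)\<in>set us. length fs = n" "w = (\<Sum>(fs, e)\<leftarrow>us. ptn n (pure sH fs) e)" by blast
    ultimately show ?thesis by (intro exI[of _ "ts @ us"]) auto
  qed
  have Pscale: "?P (fscale c v)" if "?P v" for c v
  proof -
    from that obtain ts where ts: "\<forall>(fs, e)\<in>set ts. length fs = n" "v = (\<Sum>(fs, e)\<leftarrow>ts. ptn n (pure sH fs) e)"
      by blast
    \<comment> \<open>The terms of an expansion carry no coefficients, so the scalar is absorbed
      into the factor in \<open>L\<close>.\<close>
    have "fscale c (\<Sum>(fs, e)\<leftarrow>ts. ptn n (pure sH fs) e) =
        (\<Sum>(fs, e)\<leftarrow>map (\<lambda>(fs, e). (fs, sL c e)) ts. ptn n (pure sH fs) e)"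
      using ts(1)
      by (induction ts) (auto simp: free.scale_right_distrib btens_scale_right[OF pure_in_tpow])
    then show ?thesis using ts by (intro exI[of _ "map (\<lambda>(fs, e). (fs, sL c e)) ts"]) auto
  qed
  have Ppt: "?P (ptn n m x)" if "m \<in> tpow sH n" for m x
  proof -
    have "m \<in> free.span {pure sH xs |xs. length xs = n}" using that by (simp add: tpow_def)
    then have "m \<in> tpow sH n \<and> ?P (ptn n m x)"
    proof (induction rule: free.span_induct_alt)
      case base
      have "ptn n 0 x = 0"
        using btens_scale_left[OF free.subspace_0[OF subspace_tpow], where c = 0 and sM = fscale] by simp
      then show ?case using P0 by (simp only: free.subspace_0[OF subspace_tpow])
    next
      case (step c u w)
      then obtain fs where fs: "u = pure sH fs" "length fs = n" by blast
      have u: "u \<in> tpow sH n" using fs by (simp add: pure_in_tpow)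
      have w: "w \<in> tpow sH n" using step by blast
      have "?P (ptn n u x)" using fs by (intro exI[of _ "[(fs, x)]"]) simp
      then have "?P (ptn n (fscale c u + w) x)"
        using step u w
        by (simp only: btens_add_left[OF free.subspace_scale[OF subspace_tpow u] w] btens_scale_left[OF u])
          (intro Padd Pscale, auto)
      moreover have "fscale c u + w \<in> tpow sH n"
        using u w by (intro free.subspace_add[OF subspace_tpow] free.subspace_scale[OF subspace_tpow])
      ultimately show ?case by blast
    qed
    then show ?thesis by blast
  qed
  have "?P v"
    using assms unfolding bspace_def
  proof (induction rule: free.span_induct_alt)
    case (step c u w)
    then obtain m x where "u = ptn n m x" "m \<in> tpow sH n" by blast
    then have "?P u" using Ppt by blast
    with step show ?case by (intro Padd Pscale)
  qed (rule P0)
  then show ?thesis using that by blast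
qed

text \<open>The linear map \<open>pev ys\<close> sends every expansion of \<beta> term by term to
  the required sum, so the value is independent of the expansion.\<close>

lemma annih_bracket_bracket: "annih_bracket sH cop eps sY ract sL act \<beta> bracket"
  unfolding annih_bracket_def
proof (intro conjI allI impI)
  show "multilinear_family fscale AY fscale (\<lambda>k. AY) bracket"
    unfolding multilinear_family_def
    by (simp add: bracket_in) (simp add: bracket_def mlin_ext_add mlin_ext_fscale)
next
  interpret pev: Vector_Spaces.linear fscale fscale "pev ys" for ys by (rule linear_pev)
  fix ys :: "'y list" and xs :: "'l list" and ts :: "('h list \<times> 'l) list"
  assume xs: "xs \<noteq> []" and len: "length ys = length xs"
    and ts: "\<forall>(fs, e)\<in>set ts. length fs = length xs"
    and \<beta>: "\<beta> xs = (\<Sum>(fs, e)\<leftarrow>ts. ptn (length xs) (pure sH fs) e)"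
  have ys: "ys \<noteq> []" using xs len by auto
  have "pev ys (\<Sum>(fs, e)\<leftarrow>ts. ptn (length ys) (pure sH fs) e) =
      (\<Sum>(fs, e)\<leftarrow>ts. tens (prod_nonempty (map2 ract ys fs)) e)"
    using ts len
    by (induction ts) (auto simp: pev.zero pev.add pev_ptens[OF ys, unfolded len] yev_pure)
  then show "bracket (map2 tens ys xs) = (\<Sum>(fs, e)\<leftarrow>ts. tens (prod_nonempty (map2 ract ys fs)) e)"
    by (simp add: bracket_tens len \<beta>)
qed

text \<open>Both maps agree on tuples of tensors, where the formula fixes the value. Their
  difference is multilinear and tensors span the carrier, so it vanishes.\<close>

lemma annih_bracket_unique:
  assumes b: "annih_bracket sH cop eps sY ract sL act \<beta> b" and vs: "vs \<noteq> []" "set vs \<subseteq> AY"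
  shows "b vs = bracket vs"
proof -
  let ?S = "{tens y x | y x. y \<in> UNIV \<and> x \<in> UNIV}"
  have "b vs - bracket vs \<in> {0}"
  proof (rule free_pair.multilin_subspace[where C = AY and n = "length vs" and S = "\<lambda>_. ?S"])
    show "multilin fscale AY fscale (length vs) (\<lambda>vs. b vs - bracket vs)"
      using b unfolding annih_bracket_def
      by (intro free_pair.multilin_diff multilin_bracket multilinear_family_multilin) blast
    fix gs assume gs: "length gs = length vs" "\<And>i. i < length vs \<Longrightarrow> gs ! i \<in> ?S"
    obtain ys xs where *: "length ys = length vs" "length xs = length vs" "gs = map2 tens ys xs"
      by (rule map2_nth_split[where D = "\<lambda>_. UNIV" and f = tens, OF gs(1)]) (use gs(2) in blast)
    have "xs \<noteq> []" using * vs by auto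
    obtain ts where "\<forall>(fs, e)\<in>set ts. length fs = length xs"
      "\<beta> xs = (\<Sum>(fs, e)\<leftarrow>ts. ptn (length xs) (pure sH fs) e)"
      using pspace_sum_pure[OF beta_in[OF \<open>xs \<noteq> []\<close>]] by blast
    then have "b gs = bracket gs"
      using b annih_bracket_bracket \<open>xs \<noteq> []\<close> * unfolding annih_bracket_def by metis
    then show "b gs - bracket gs \<in> {0}" by simp
  next
    fix i assume "i < length vs"
    then have "vs ! i \<in> AY" using vs by (meson nth_mem subsetD)
    then show "vs ! i \<in> free.span ?S" by (simp add: bspace_def)
  qed (auto intro: btens_in_bspace simp: subspace_bspace free.subspace_single_0)
  then show ?thesis by simp
qed

section \<open>Homogeneous tensors and compositions of brackets\<close>

text \<open>The component of degree \<open>d\<close> is spanned by tensors with second factor in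
  \<open>G d\<close>, so \<open>multilin_subspace\<close> applies with generators chosen according
  to the degree of each slot.\<close>

lemma homogeneous_annih_cases:
  assumes f: "multilin fscale UNIV fscale (length vs) f" and W: "free.subspace W"
    and vs: "homogeneous (annih_grading sY ract sL act G) ds vs"
    and gens: "\<And>ys xs. length ys = length vs \<Longrightarrow> length xs = length vs \<Longrightarrow> homogeneous G ds xs \<Longrightarrow>
      f (map2 tens ys xs) \<in> W"
  shows "f vs \<in> W"
proof (rule free_pair.multilin_subspace[where C = UNIV and n = "length vs"
      and S = "\<lambda>i. {tens y x | y x. y \<in> UNIV \<and> x \<in> G (ds ! i)}"])
  fix gs assume gs: "length gs = length vs"
    "\<And>i. i < length vs \<Longrightarrow> gs ! i \<in> {tens y x | y x. y \<in> UNIV \<and> x \<in> G (ds ! i)}"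
  obtain ys xs where *: "length ys = length vs" "length xs = length vs" "gs = map2 tens ys xs"
    "\<And>i. i < length vs \<Longrightarrow> xs ! i \<in> G (ds ! i)"
    by (rule map2_nth_split[where D = "\<lambda>i. G (ds ! i)" and f = tens, OF gs(1)]) (use gs(2) in blast)+
  moreover have "length ds = length vs" using vs by (auto simp: homogeneous_def dest: list_all2_lengthD)
  ultimately have "homogeneous G ds xs"
    by (simp add: homogeneous_def list_all2_conv_all_nth)
  then show "f gs \<in> W" using gens * by simp
next
  fix i assume "i < length vs"
  then have "vs ! i \<in> bspace sY UNIV ract sL act (G (ds ! i))"
    using vs by (simp add: homogeneous_def list_all2_conv_all_nth)
  then show "vs ! i \<in> free.span {tens y x | y x. y \<in> UNIV \<and> x \<in> G (ds ! i)}"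
    by (simp add: bspace_def)
qed (auto simp: f W)

text \<open>The core of the comparison of compositions. The action of the first factor of
  \<open>w\<close> on \<open>u\<close> turns into its action on the product
  \<open>yev ys1 u\<close>, and grouping the initial block leaves that single element in front of
  \<open>ys2\<close>.\<close>

lemma yev_tconc_cons:
  assumes ys1: "ys1 \<noteq> []" and u: "u \<in> tpow sH (length ys1)" and w: "w \<in> tpow sH (Suc (length ys2))"
  shows "yev (ys1 @ ys2) (lin_ext fscale (\<lambda>fs. tconc sH (tactH (length ys1) u (hd fs)) (pure sH (tl fs))) w)
    = yev (yev ys1 u # ys2) w"
  unfolding linear_lin_ext_comp[OF linear_yev] yev_def[of "yev ys1 u # ys2"]
proof (rule lin_ext_cong)
  fix fs assume "fs \<in> Poly_Mapping.keys w"
  then have "length fs = Suc (length ys2)" by (rule keys_tpow[OF w])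
  then obtain f gs where fs: "fs = f # gs" and gs: "length gs = length ys2"
    by (auto simp: length_Suc_conv)
  let ?u = "tactH (length ys1) u f" and ?zs = "map2 ract ys2 gs"
  have u': "?u \<in> tpow sH (length ys1)" by (rule tact_in_tpow[OF u])
  \<comment> \<open>Linearity in the first factor carries the sum over the terms of
    \<open>?u\<close> inside the product.\<close>
  have lin: "Vector_Spaces.linear sY sY (\<lambda>z. prod_nonempty (z # ?zs))"
    using multilin_append_add[OF multilin_prod_nonempty refl, where us = "[]" and vs = ?zs]
      multilin_append_scale[OF multilin_prod_nonempty refl, where us = "[]" and vs = ?zs]
    by unfold_locales simp_all
  have "yev (ys1 @ ys2) (tconc sH ?u (pure sH gs)) =
      lin_ext sY (\<lambda>xs. prod_nonempty (map2 ract (ys1 @ ys2) (xs @ gs))) ?u"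
    unfolding yev_def
    by (rule Y.lin_ext_tconc_pure_right[OF multilin_prod_ract u']) (simp add: gs)
  also have "\<dots> = lin_ext sY (\<lambda>xs. prod_nonempty (prod_nonempty (map2 ract ys1 xs) # ?zs)) ?u"
  proof (rule lin_ext_cong)
    fix xs assume "xs \<in> Poly_Mapping.keys ?u"
    then have "length xs = length ys1" by (rule keys_tpow[OF u'])
    then show "prod_nonempty (map2 ract (ys1 @ ys2) (xs @ gs)) =
        prod_nonempty (prod_nonempty (map2 ract ys1 xs) # ?zs)"
      using ys1 by (subst prod_nonempty_append[symmetric]) auto
  qed
  also have "\<dots> = prod_nonempty (yev ys1 ?u # ?zs)"
    by (simp only: yev_def linear_lin_ext_comp[OF lin])
  finally show "yev (ys1 @ ys2) (tconc sH (tactH (length ys1) u (hd fs)) (pure sH (tl fs))) =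
      prod_nonempty (map2 ract (yev ys1 u # ys2) fs)"
    by (simp add: fs yev_tact[OF ys1 u])
qed

text \<open>For a term \<open>(u, e)\<close> of \<open>v\<close>, the outer bracket evaluates
  \<open>\<beta> (e # xs2)\<close> on \<open>yev ys1 u # ys2\<close>. By
  \<open>yev_tconc_cons\<close> this is the evaluation of the corresponding part of
  \<open>pcomp\<close> on all of \<open>ys1 @ ys2\<close>.\<close>

lemma bracket_pev_Cons:
  assumes ys1: "ys1 \<noteq> []" and len: "length ys2 = length xs2" and v: "v \<in> psp (length ys1) UNIV"
  shows "bracket (pev ys1 v # map2 tens ys2 xs2) =
    pev (ys1 @ ys2) (pcomp sH cop eps sL act \<beta> (length ys1) v xs2)"
proof -
  have lin: "Vector_Spaces.linear fscale fscale (\<lambda>a. bracket (a # map2 tens ys2 xs2))"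
    by unfold_locales (simp_all add: bracket_def free.lin_ext_add free.lin_ext_fscale)
  have len': "length ys1 + length xs2 = length (ys1 @ ys2)" using len by simp
  have "bracket (pev ys1 v # map2 tens ys2 xs2) =
      lin_ext fscale (\<lambda>(u, e). pev (yev ys1 u # ys2) (\<beta> (e # xs2))) v"
    unfolding pev_def[of ys1] linear_lin_ext_comp[OF lin]
    using bracket_tens[of "_ # ys2" "_ # xs2"] len by (intro lin_ext_cong) (auto split: prod.split)
  also have "\<dots> = pev (ys1 @ ys2) (pcomp sH cop eps sL act \<beta> (length ys1) v xs2)"
    unfolding pcomp_def linear_lin_ext_comp[OF linear_pev]
  proof (rule lin_ext_cong, clarify)
    fix u e assume "(u, e) \<in> Poly_Mapping.keys v"
    then have u: "u \<in> tpow sH (length ys1)" using v by (rule keys_pspace[rotated])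
    show "pev (yev ys1 u # ys2) (\<beta> (e # xs2)) = pev (ys1 @ ys2) (lin_ext fscale (\<lambda>(w, e').
        ptn (length ys1 + length xs2) (lin_ext fscale (\<lambda>fs. tconc sH (tactH (length ys1) u (hd fs))
          (pure sH (tl fs))) w) e') (\<beta> (e # xs2)))"
      unfolding linear_lin_ext_comp[OF linear_pev] len' pev_def[of "_ # _"]
    proof (rule lin_ext_cong, clarify)
      fix w e' assume "(w, e') \<in> Poly_Mapping.keys (\<beta> (e # xs2))"
      then have w: "w \<in> tpow sH (Suc (length ys2))"
        using beta_in[of "e # xs2"] len by (auto dest: keys_pspace[rotated])
      show "tens (yev (yev ys1 u # ys2) w) e' = pev (ys1 @ ys2) (ptn (length (ys1 @ ys2))
          (lin_ext fscale (\<lambda>fs. tconc sH (tactH (length ys1) u (hd fs)) (pure sH (tl fs))) w) e')"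
        using ys1 by (subst pev_ptens) (simp_all add: yev_tconc_cons[OF ys1 u w])
    qed
  qed
  finally show ?thesis .
qed

text \<open>Supplies the membership under which \<open>pev_pmap_tperm\<close> applies to a
  composition.\<close>

lemma pcomp_in_pspace:
  assumes v: "v \<in> psp l UNIV"
  shows "pcomp sH cop eps sL act \<beta> l v xs \<in> psp (l + length xs) UNIV"
  unfolding pcomp_def
proof (intro free.lin_ext_in_subspace[OF subspace_bspace], clarify,
    intro free.lin_ext_in_subspace[OF subspace_bspace], clarify)
  fix u e w e'
  assume "(u, e) \<in> Poly_Mapping.keys v" and "(w, e') \<in> Poly_Mapping.keys (\<beta> (e # xs))"
  then have u: "u \<in> tpow sH l" and w: "w \<in> tpow sH (Suc (length xs))"
    using keys_pspace[OF v] keys_pspace[OF beta_in[of "e # xs"]] by auto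
  show "ptn (l + length xs)
      (lin_ext fscale (\<lambda>fs. tconc sH (tactH l u (hd fs)) (pure sH (tl fs))) w) e' \<in> psp (l + length xs) UNIV"
    by (intro btens_in_bspace free.lin_ext_in_subspace[OF subspace_tpow] tconc_in_tpow tact_in_tpow u
        pure_in_tpow UNIV_I) (simp add: keys_tpow[OF w])
qed

section \<open>The grading of the annihilation algebra\<close>

lemma gproj_act: "L.gproj G n (act h x) = act h (L.gproj G n x)"
  by (rule L.gproj_commute[OF L.graded _ L.graded_act], unfold_locales)
    (simp_all add: L.act_add_right L.act_scale_right)

text \<open>The components span because those of \<open>L\<close> do. They are independent because
  the \<open>H\<close>-linear projections of \<open>L\<close> induce projections of the tensor
  product.\<close>

lemma graded_space_annih: "graded_space fscale AY (annih_grading sY ract sL act G)"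
  unfolding graded_space_def
proof (intro conjI allI impI)
  let ?G = "annih_grading sY ract sL act G"
  show "free.subspace (?G n)" for n by (rule subspace_bspace)
  have "free.span (\<Union>n. ?G n) \<subseteq> AY"
    by (rule free.span_minimal[OF _ subspace_bspace]) (use bspace_mono[OF subset_UNIV] in blast)
  moreover have "AY \<subseteq> free.span (\<Union>n. ?G n)"
    unfolding bspace_def[of _ _ _ _ _ UNIV]
  proof (rule free.span_minimal[OF _ free.subspace_span], clarify)
    fix y x
    interpret tens: Vector_Spaces.linear sL fscale "tens y" by (rule linear_tens_right)
    have "x \<in> L.span (\<Union>n. G n)" using L.graded by (simp add: graded_space_def)
    then show "tens y x \<in> free.span (\<Union>n. ?G n)"
    proof (induction rule: L.span_induct_alt)
      case base
      show ?case by (simp add: tens.zero free.span_zero)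
    next
      case (step c x z)
      then obtain n where "x \<in> G n" by blast
      then have "tens y x \<in> free.span (\<Union>n. ?G n)"
        by (intro free.span_base UN_I[of n]) (simp_all add: btens_in_bspace)
      with step show ?case by (simp add: tens.add tens.scale free.span_add free.span_scale)
    qed
  qed
  ultimately show "AY = free.span (\<Union>n. ?G n)" by blast
  fix I v
  assume I: "finite I" and v: "\<forall>n\<in>I. v n \<in> ?G n" and sum: "(\<Sum>n\<in>I. v n) = 0"
  show "\<forall>n\<in>I. v n = 0"
  proof
    fix n assume n: "n \<in> I"
    \<comment> \<open>This is the identity of \<open>Y\<close> tensored over \<open>H\<close> with
      the projection to degree \<open>n\<close>; it fixes degree \<open>n\<close> and kills all
      other degrees.\<close>
    let ?p = "lin_ext fscale (\<lambda>(y, x). tens y (L.gproj G n x))"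
    interpret tens: Vector_Spaces.linear sL fscale "tens y" for y by (rule linear_tens_right)
    interpret p: Vector_Spaces.linear fscale fscale ?p by (rule free.linear_lin_ext)
    have p: "?p (tens y x) = tens y (L.gproj G n x)" for y x
    proof -
      have "?p (tens y x) = (\<lambda>(y, x). tens y (L.gproj G n x)) (y, x)"
        using L.linear_gproj[OF L.graded, of n] linear_tens_left linear_tens_right
        by (intro free.lin_ext_btens) (simp_all add: Vector_Spaces.linear_iff gproj_act btens_balanced)
      then show ?thesis by simp
    qed
    have "?p w = (if m = n then w else 0)" if "w \<in> ?G m" for w m
      using that unfolding bspace_def
    proof (induction rule: free.span_induct_alt)
      case (step c u w)
      then obtain y x where "u = tens y x" "x \<in> G m" by blast
      then have "?p u = (if m = n then u else 0)"
        by (auto simp: p L.gproj_same[OF L.graded] L.gproj_other[OF L.graded] tens.zero)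
      with step show ?case by (simp add: p.add p.scale)
    qed simp
    then have "?p (\<Sum>m\<in>I. v m) = (\<Sum>m\<in>I. if m = n then v m else 0)"
      using v by (auto simp: p.sum intro!: sum.cong)
    also have "\<dots> = v n" using I n by simp
    finally show "v n = 0" using sum by simp
  qed
qed

section \<open>Verification of the axioms\<close>

lemma L_infty_bracket: "L_infty_algebra fscale AY (annih_grading sY ract sL act G) bracket"
proof
  show "graded_space fscale AY (annih_grading sY ract sL act G)" by (rule graded_space_annih)
  show "multilinear_family fscale AY fscale (\<lambda>k. AY) bracket"
    using annih_bracket_bracket by (simp add: annih_bracket_def)
next
  fix vs ds assume vs: "vs \<noteq> []" and hom: "homogeneous (annih_grading sY ract sL act G) ds vs"
  show "bracket vs \<in> annih_grading sY ract sL act G (sum_list ds + int (length vs) - 2)"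
  proof (rule homogeneous_annih_cases[OF multilin_bracket subspace_bspace hom])
    fix ys :: "'y list" and xs :: "'l list"
    assume len: "length ys = length vs" "length xs = length vs" and hom': "homogeneous G ds xs"
    have ne: "ys \<noteq> []" "xs \<noteq> []" using len vs by auto
    show "bracket (map2 tens ys xs) \<in> annih_grading sY ract sL act G (sum_list ds + int (length vs) - 2)"
      using L.degree[OF ne(2) hom'] len by (simp add: bracket_tens pev_in_bspace[OF ne(1)])
  qed
next
  fix vs ds \<sigma> assume vs: "vs \<noteq> []" and hom: "homogeneous (annih_grading sY ract sL act G) ds vs"
    and \<sigma>: "\<sigma> permutes {..<length vs}"
  let ?c = "sign \<sigma> * koszul_sign ds \<sigma>"
  \<comment> \<open>The identity is written as membership of a difference in \<open>{0}\<close>, so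
    that the reduction to homogeneous tensors applies.\<close>
  have "bracket vs - fscale (of_int ?c) (bracket (permute_list \<sigma> vs)) \<in> {0}"
  proof (rule homogeneous_annih_cases[OF _ free.subspace_single_0 hom])
    show "multilin fscale UNIV fscale (length vs)
        (\<lambda>vs. bracket vs - fscale (of_int ?c) (bracket (permute_list \<sigma> vs)))"
      by (intro free_pair.multilin_diff free_pair.multilin_scale multilin_permute_list multilin_bracket \<sigma>)
    fix ys :: "'y list" and xs :: "'l list"
    assume len: "length ys = length vs" "length xs = length vs" and hom': "homogeneous G ds xs"
    have ne: "ys \<noteq> []" "xs \<noteq> []" "permute_list \<sigma> xs \<noteq> []"
      using len vs by (auto simp: permute_list_def)
    interpret pev: Vector_Spaces.linear fscale fscale "pev ys" by (rule linear_pev)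
    have "pev ys (\<beta> xs) = fscale (of_int ?c) (pev ys (pmp (length ys) (tperm sH \<sigma>) (\<beta> (permute_list \<sigma> xs))))"
      using L.skew_symmetric[OF ne(2) hom', of \<sigma>] \<sigma> len by (simp add: sscale_def pev.scale)
    also have "\<dots> = fscale (of_int ?c) (pev (permute_list \<sigma> ys) (\<beta> (permute_list \<sigma> xs)))"
      using pev_pmap_tperm[OF ne(1), of \<sigma> "\<beta> (permute_list \<sigma> xs)" UNIV] beta_in[OF ne(3)] \<sigma> len by simp
    finally show "bracket (map2 tens ys xs) -
        fscale (of_int ?c) (bracket (permute_list \<sigma> (map2 tens ys xs))) \<in> {0}"
      using \<sigma> len by (simp add: bracket_tens flip: map2_permute_list)
  qed
  then show "bracket vs = sscale fscale ?c (bracket (permute_list \<sigma> vs))"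
    by (simp add: sscale_def)
next
  fix vs ds assume vs: "vs \<noteq> []" and hom: "homogeneous (annih_grading sY ract sL act G) ds vs"
  let ?n = "length vs"
  let ?c = "\<lambda>l \<sigma>. of_int (sign \<sigma> * koszul_sign ds \<sigma> * (- 1) ^ (l * (?n - l))) :: 'k"
  \<comment> \<open>Since \<open>l\<close> is at most \<open>?n\<close>, the truncated subtraction
    is exact and \<open>l + (?n - l)\<close> equals \<open>?n\<close>.\<close>
  have perm: "\<sigma> permutes {..<?n}" if "l \<in> {1..?n}" "\<sigma> \<in> shuffles_on l (?n - l)" for l \<sigma>
    using that by (simp add: shuffles_on_def)
  \<comment> \<open>With the degrees and signs held fixed, the Jacobi sum is a multilinear function
    of its arguments.\<close>
  let ?f = "\<lambda>ws. \<Sum>l = 1..?n. \<Sum>\<sigma>\<in>shuffles_on l (?n - l). fscale (?c l \<sigma>)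
      (bracket (bracket (take l (permute_list \<sigma> ws)) # drop l (permute_list \<sigma> ws)))"
  have "?f vs \<in> {0}"
  proof (rule homogeneous_annih_cases[where f = ?f, OF _ free.subspace_single_0 hom])
    show "multilin fscale UNIV fscale ?n ?f"
    proof (intro free_pair.multilin_sum free_pair.multilin_scale)
      fix l \<sigma> assume l: "l \<in> {1..?n}" and \<sigma>: "\<sigma> \<in> shuffles_on l (?n - l)"
      show "multilin fscale UNIV fscale ?n
          (\<lambda>vs. bracket (bracket (take l (permute_list \<sigma> vs)) # drop l (permute_list \<sigma> vs)))"
        using l by (intro multilin_permute_list[OF multilin_nested[OF multilin_bracket] perm[OF l \<sigma>]]) simp
    qed
    fix ys :: "'y list" and xs :: "'l list"
    assume len: "length ys = ?n" "length xs = ?n" and hom': "homogeneous G ds xs"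
    have ne: "ys \<noteq> []" "xs \<noteq> []" using len vs by auto
    interpret pev: Vector_Spaces.linear fscale fscale "pev ys" by (rule linear_pev)
    let ?J = "\<lambda>l \<sigma>. pmp ?n (tperm sH \<sigma>) (pcomp sH cop eps sL act \<beta> l (\<beta> (take l (permute_list \<sigma> xs)))
        (drop l (permute_list \<sigma> xs)))"
    \<comment> \<open>The inner bracket is an evaluation, \<open>bracket_pev_Cons\<close> turns the
      nested brackets into the evaluation of \<open>pcomp\<close> on the permuted \<open>ys\<close>,
      and \<open>pev_pmap_tperm\<close> trades that permutation for \<open>tperm\<close>.\<close>
    have "bracket (bracket (take l (permute_list \<sigma> (map2 tens ys xs))) # drop l (permute_list \<sigma> (map2 tens ys xs))) =
        pev ys (?J l \<sigma>)" if l: "l \<in> {1..?n}" and \<sigma>: "\<sigma> \<in> shuffles_on l (?n - l)" for l \<sigma>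
    proof -
      note p = perm[OF l \<sigma>]
      let ?ys = "permute_list \<sigma> ys" and ?xs = "permute_list \<sigma> xs"
      have eq: "permute_list \<sigma> (map2 tens ys xs) = map2 tens ?ys ?xs"
        using map2_permute_list[of \<sigma> xs ys tens] p len by simp
      have l': "length (take l ?ys) = l" "length (take l ?xs) = l" using l len by auto
      have ne': "take l ?ys \<noteq> []" "take l ?xs \<noteq> []" using l ne by (auto simp: permute_list_def)
      have psp: "\<beta> (take l ?xs) \<in> psp l UNIV" using beta_in[OF ne'(2)] l' by simp
      have "bracket (bracket (take l (map2 tens ?ys ?xs)) # drop l (map2 tens ?ys ?xs)) =
          bracket (pev (take l ?ys) (\<beta> (take l ?xs)) # map2 tens (drop l ?ys) (drop l ?xs))"
        using len by (simp add: take_map drop_map take_zip drop_zip bracket_tens)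
      also have "\<dots> = pev (take l ?ys @ drop l ?ys) (pcomp sH cop eps sL act \<beta> l (\<beta> (take l ?xs)) (drop l ?xs))"
        using bracket_pev_Cons[OF ne'(1), of "drop l ?ys" "drop l ?xs" "\<beta> (take l ?xs)"] l' psp len by simp
      also have "\<dots> = pev ?ys (pcomp sH cop eps sL act \<beta> l (\<beta> (take l ?xs)) (drop l ?xs))" by simp
      also have "\<dots> = pev ys (?J l \<sigma>)"
        using pev_pmap_tperm[OF ne(1), of \<sigma> _ UNIV] pcomp_in_pspace[OF psp, of "drop l ?xs"] p l len by simp
      finally show ?thesis by (simp only: eq)
    qed
    then have "?f (map2 tens ys xs) =
      (\<Sum>l = 1..?n. \<Sum>\<sigma>\<in>shuffles_on l (?n - l). fscale (?c l \<sigma>) (pev ys (?J l \<sigma>)))"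
      by (intro sum.cong refl) simp
    also have "\<dots> = pev ys (\<Sum>l = 1..?n. \<Sum>\<sigma>\<in>shuffles_on l (?n - l). fscale (?c l \<sigma>) (?J l \<sigma>))"
      by (simp only: pev.sum pev.scale)
    also have "(\<Sum>l = 1..?n. \<Sum>\<sigma>\<in>shuffles_on l (?n - l). fscale (?c l \<sigma>) (?J l \<sigma>)) = 0"
      using L.jacobi[OF ne(2) hom'] by (simp only: sscale_def len)
    finally show "?f (map2 tens ys xs) \<in> {0}"
      by (simp add: pev.zero)
  qed
  then show "(\<Sum>l = 1..?n. \<Sum>\<sigma>\<in>shuffles_on l (?n - l).
      sscale fscale (sign \<sigma> * koszul_sign ds \<sigma> * (- 1) ^ (l * (?n - l)))
        (bracket (bracket (take l (permute_list \<sigma> vs)) # drop l (permute_list \<sigma> vs)))) = 0"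
    by (simp only: sscale_def singleton_iff)
qed

section \<open>Compatibility with the left action of \<open>H\<close>\<close>

text \<open>The bimodule law makes \<open>lact h\<close> commute with the right action, so it
  descends to the tensor product over \<open>H\<close>.\<close>

lemma annih_act_tens: "annih_act sY lact ract sL act h (tens y x) = tens (lact h y) x"
proof -
  have "lin_ext fscale (\<lambda>(y, x). tens (lact h y) x) (tens y x) = (\<lambda>(y, x). tens (lact h y) x) (y, x)"
    using linear_lact[of h] linear_tens_left linear_tens_right
    by (intro free.lin_ext_btens)
      (simp_all add: Vector_Spaces.linear_iff btens_balanced flip: Y.bimodule)
  then show ?thesis by (simp add: bmap_def)
qed

text \<open>The left Leibniz rule distributes \<open>h\<close> over the factors \<open>y f\<close>,
  and the bimodule law moves each part of it past \<open>f\<close> onto \<open>y\<close>.\<close>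

lemma lact_yev:
  assumes "ys \<noteq> []" "m \<in> tpow sH (length ys)"
  shows "lact h (yev ys m) = lin_ext sY (\<lambda>hs. yev (map2 lact hs ys) m) (copn (length ys) h)"
proof -
  have "lact h (yev ys m) = lin_ext sY (\<lambda>fs. lin_ext sY (\<lambda>hs. prod_nonempty (map2 ract (map2 lact hs ys) fs))
      (copn (length ys) h)) m"
    unfolding yev_def linear_lin_ext_comp[OF linear_lact]
  proof (rule lin_ext_cong)
    fix fs assume "fs \<in> Poly_Mapping.keys m"
    then have len: "length fs = length ys" by (rule keys_tpow[OF assms(2)])
    have "map2 ract (map2 lact hs ys) fs = map2 lact hs (map2 ract ys fs)" for hs
      by (rule nth_equalityI) (simp_all add: Y.bimodule)
    moreover have "map2 ract ys fs \<noteq> []" using assms(1) len by auto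
    ultimately show "lact h (prod_nonempty (map2 ract ys fs)) =
        lin_ext sY (\<lambda>hs. prod_nonempty (map2 ract (map2 lact hs ys) fs)) (copn (length ys) h)"
      using lact_prod_nonempty[of "map2 ract ys fs" h] len by simp
  qed
  then show ?thesis by (simp add: yev_def Y.lin_ext_swap[of _ m])
qed

text \<open>Apply \<open>lact_yev\<close> to every term of \<beta> and interchange the sum over
  these terms with the Sweedler sum.\<close>

lemma annih_act_bracket:
  assumes "xs \<noteq> []" "length ys = length xs"
  shows "annih_act sY lact ract sL act h (bracket (map2 tens ys xs)) =
    lin_ext fscale (\<lambda>hs. bracket (map2 (annih_act sY lact ract sL act) hs (map2 tens ys xs)))
      (copn (length xs) h)"
proof -
  have ys: "ys \<noteq> []" using assms by auto
  have lin: "Vector_Spaces.linear fscale fscale (annih_act sY lact ract sL act h)"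
    unfolding bmap_def[abs_def] by (rule free.linear_lin_ext)
  have "annih_act sY lact ract sL act h (bracket (map2 tens ys xs)) =
      lin_ext fscale (\<lambda>(m, x). tens (lact h (yev ys m)) x) (\<beta> xs)"
    unfolding bracket_tens[OF assms(2)] pev_def linear_lin_ext_comp[OF lin]
    by (intro lin_ext_cong) (auto simp: annih_act_tens)
  also have "\<dots> = lin_ext fscale (\<lambda>q. lin_ext fscale
      (\<lambda>hs. (\<lambda>(m, x). tens (yev (map2 lact hs ys) m) x) q) (copn (length xs) h)) (\<beta> xs)"
  proof (intro lin_ext_cong, clarify)
    fix m x assume "(m, x) \<in> Poly_Mapping.keys (\<beta> xs)"
    then have "m \<in> tpow sH (length ys)" using beta_in[OF assms(1)] assms(2) by (auto dest: keys_pspace[rotated])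
    then show "tens (lact h (yev ys m)) x =
        lin_ext fscale (\<lambda>hs. tens (yev (map2 lact hs ys) m) x) (copn (length xs) h)"
      by (simp add: lact_yev[OF ys] linear_lin_ext_comp[OF linear_tens_left] assms(2))
  qed
  also have "\<dots> = lin_ext fscale (\<lambda>hs. pev (map2 lact hs ys) (\<beta> xs)) (copn (length xs) h)"
    by (simp only: free.lin_ext_swap[of _ _ "\<beta> xs"] pev_def)
  also have "\<dots> = lin_ext fscale (\<lambda>hs. bracket (map2 (annih_act sY lact ract sL act) hs (map2 tens ys xs)))
      (copn (length xs) h)"
  proof (rule lin_ext_cong)
    fix hs assume "hs \<in> Poly_Mapping.keys (copn (length xs) h)"
    then have len: "length hs = length xs" by (rule keys_tpow[OF cop_iter_in_tpow])
    have "map2 (annih_act sY lact ract sL act) hs (map2 tens ys xs) = map2 tens (map2 lact hs ys) xs"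
      by (rule nth_equalityI) (simp_all add: annih_act_tens)
    then show "pev (map2 lact hs ys) (\<beta> xs) =
        bracket (map2 (annih_act sY lact ract sL act) hs (map2 tens ys xs))"
      using len assms(2) by (simp add: bracket_tens)
  qed
  finally show ?thesis .
qed

end

text \<open>A function \<open>b\<close> takes all lists over the ambient free space as arguments,
  whereas the formula determines it only on nonempty lists over the carrier; uniqueness is asserted
  there.\<close>

theorem proposition3p14:
  fixes sH :: "'k::field \<Rightarrow> 'h::ring_1 \<Rightarrow> 'h"
    and cop :: "'h \<Rightarrow> ('h list \<Rightarrow>\<^sub>0 'k)" and eps :: "'h \<Rightarrow> 'k" and antipode :: "'h \<Rightarrow> 'h"
    and sY :: "'k \<Rightarrow> 'y::comm_ring \<Rightarrow> 'y"
    and lact :: "'h \<Rightarrow> 'y \<Rightarrow> 'y" and ract :: "'y \<Rightarrow> 'h \<Rightarrow> 'y"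
    and sL :: "'k \<Rightarrow> 'l::ab_group_add \<Rightarrow> 'l" and act :: "'h \<Rightarrow> 'l \<Rightarrow> 'l"
    and G :: "int \<Rightarrow> 'l set"
    and \<beta> :: "'l list \<Rightarrow> (('h list \<Rightarrow>\<^sub>0 'k) \<times> 'l \<Rightarrow>\<^sub>0 'k)"
  assumes "cocommutative_hopf_algebra sH cop eps antipode"
    and "differential_bimodule_algebra sH cop sY lact ract"
    and "L_infty_pseudoalgebra sH cop eps sL act G \<beta>"
  shows "\<exists>b. annih_bracket sH cop eps sY ract sL act \<beta> b \<and>
    (\<forall>b'. annih_bracket sH cop eps sY ract sL act \<beta> b' \<longrightarrow>
       (\<forall>vs. vs \<noteq> [] \<longrightarrow> set vs \<subseteq> annih_space sY ract sL act \<longrightarrow> b' vs = b vs)) \<and>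
    L_infty_algebra fscale (annih_space sY ract sL act) (annih_grading sY ract sL act G) b \<and>
    (\<forall>h y x. annih_act sY lact ract sL act h (annih_tens sY ract sL act y x) =
       annih_tens sY ract sL act (lact h y) x) \<and>
    (\<forall>h ys xs. xs \<noteq> [] \<longrightarrow> length ys = length xs \<longrightarrow>
       annih_act sY lact ract sL act h (b (map2 (annih_tens sY ract sL act) ys xs)) =
       lin_ext fscale
         (\<lambda>hs. b (map2 (annih_act sY lact ract sL act) hs
                    (map2 (annih_tens sY ract sL act) ys xs)))
         (cop_iter sH cop eps (length xs) h))"
proof -
  interpret annihilation sH cop eps antipode sY lact ract sL act G \<beta>
    using assms by (rule annihilation.intro)
  show ?thesis
    using annih_bracket_bracket annih_bracket_unique L_infty_bracket annih_act_tens annih_act_bracket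
    by blast
qed

end
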